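(* Let $A$ and $B$ be unital associative algebras over a field $k$. Any twist map $\psi: B\otimes A\to A\otimes B$ which is a morphism in the category ${}_{B}M_{A}$ satisfies $$(\mathrm{id}_A\otimes m_B)(\psi\otimes\mathrm{id}_B)(\mathrm{id}_B\otimes m_A\otimes\mathrm{id}_B)(\mathrm{id}_B\otimes\mathrm{id}_A\otimes\psi)=(m_A\otimes\mathrm{id}_B)(\mathrm{id}_A\otimes\psi)(\mathrm{id}_A\otimes m_B\otimes\mathrm{id}_A)(\psi\otimes\mathrm{id}_B\otimes\mathrm{id}_A),$$ and hence $m_\psi:=(m_A\otimes m_B)(\mathrm{id}_A\otimes\psi\otimes\mathrm{id}_B)$ is an associative product on $A\otimes B$.
   Context: $m_A,m_B$ are the multiplications of $A,B$. A twist map is a $k$-linear map $B\otimes A\to A\otimes B$. ${}_{B}M_{A}$ is the category of left $B$-modules and right $A$-modules (with commuting actions), whose morphisms are the left $B$-linear and right $A$-linear maps. $B\otimes A$ is an object via $b'\cdot(b\otimes a)=b'b\otimes a$ and $(b\otimes a)\cdot a'=b\otimes aa'$; $A\otimes B$ is an object via $b'\cdot(a\otimes b)=a\otimes b'b$ and $(a\otimes b)\cdot a'=aa'\otimes b$. *)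

theory Defs
  imports "HOL.Hull" "HOL-Algebra.Module" "HOL-Algebra.AbelCoset"
begin

section \<open>Linear algebra over a commutative ring\<close>

text \<open>Only \<open>carrier\<close>, \<open>zero\<close>, \<open>add\<close> and \<open>smult\<close> of a \<^typ>\<open>('a, 'b) module\<close> record belong to
  the module structure; the fields \<open>mult\<close> and \<open>one\<close> of the modules constructed here are left
  unspecified.\<close>

definition module_hom ::
  "('k, 'r) ring_scheme \<Rightarrow> ('k, 'm, 'x) module_scheme \<Rightarrow> ('k, 'n, 'y) module_scheme \<Rightarrow> ('m \<Rightarrow> 'n) set"
  where "module_hom R M N = {h \<in> carrier M \<rightarrow> carrier N.
     (\<forall>x\<in>carrier M. \<forall>y\<in>carrier M. h (x \<oplus>\<^bsub>M\<^esub> y) = h x \<oplus>\<^bsub>N\<^esub> h y) \<and>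
     (\<forall>r\<in>carrier R. \<forall>x\<in>carrier M. h (r \<odot>\<^bsub>M\<^esub> x) = r \<odot>\<^bsub>N\<^esub> h x)}"

definition bilinear_maps ::
  "('k, 'r) ring_scheme \<Rightarrow> ('k, 'm, 'x) module_scheme \<Rightarrow> ('k, 'n, 'y) module_scheme \<Rightarrow>
   ('k, 'p, 'z) module_scheme \<Rightarrow> ('m \<Rightarrow> 'n \<Rightarrow> 'p) set"
  where "bilinear_maps R M N P = {f.
     (\<forall>x\<in>carrier M. f x \<in> module_hom R N P) \<and>
     (\<forall>y\<in>carrier N. (\<lambda>x. f x y) \<in> module_hom R M P)}"

definition free_module :: "('k, 'r) ring_scheme \<Rightarrow> 's set \<Rightarrow> ('k, 's \<Rightarrow> 'k) module"
  where "free_module R S = \<lparr>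
     carrier = {u. (\<forall>s. u s \<in> carrier R) \<and> (\<forall>s. s \<notin> S \<longrightarrow> u s = \<zero>\<^bsub>R\<^esub>) \<and> finite {s. u s \<noteq> \<zero>\<^bsub>R\<^esub>}},
     mult = undefined, one = undefined,
     zero = (\<lambda>s. \<zero>\<^bsub>R\<^esub>), add = (\<lambda>u v s. u s \<oplus>\<^bsub>R\<^esub> v s),
     smult = (\<lambda>r u s. r \<otimes>\<^bsub>R\<^esub> u s)\<rparr>"

definition free_gen :: "('k, 'r) ring_scheme \<Rightarrow> 's \<Rightarrow> 's \<Rightarrow> 'k"
  where "free_gen R s = (\<lambda>t. if t = s then \<one>\<^bsub>R\<^esub> else \<zero>\<^bsub>R\<^esub>)"

definition quotient_module ::
  "('k, 'm, 'x) module_scheme \<Rightarrow> 'm set \<Rightarrow> ('k, 'm set) module"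
  where "quotient_module M H = \<lparr>
     carrier = a_rcosets\<^bsub>M\<^esub> H,
     mult = undefined, one = undefined,
     zero = H, add = set_add M,
     smult = (\<lambda>r X. \<Union>x\<in>X. H +>\<^bsub>M\<^esub> (r \<odot>\<^bsub>M\<^esub> x))\<rparr>"


section \<open>The tensor product\<close>

definition tensor_relators ::
  "('k, 'r) ring_scheme \<Rightarrow> ('k, 'm, 'x) module_scheme \<Rightarrow> ('k, 'n, 'y) module_scheme \<Rightarrow>
   ('m \<times> 'n \<Rightarrow> 'k) set"
  where "tensor_relators R M N =
    (let F = free_module R (carrier M \<times> carrier N); \<delta> = (\<lambda>x y. free_gen R (x, y)) in
      {\<delta> (x \<oplus>\<^bsub>M\<^esub> x') y \<ominus>\<^bsub>F\<^esub> (\<delta> x y \<oplus>\<^bsub>F\<^esub> \<delta> x' y) | x x' y.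
         x \<in> carrier M \<and> x' \<in> carrier M \<and> y \<in> carrier N} \<union>
      {\<delta> x (y \<oplus>\<^bsub>N\<^esub> y') \<ominus>\<^bsub>F\<^esub> (\<delta> x y \<oplus>\<^bsub>F\<^esub> \<delta> x y') | x y y'.
         x \<in> carrier M \<and> y \<in> carrier N \<and> y' \<in> carrier N} \<union>
      {\<delta> (r \<odot>\<^bsub>M\<^esub> x) y \<ominus>\<^bsub>F\<^esub> r \<odot>\<^bsub>F\<^esub> \<delta> x y | r x y.
         r \<in> carrier R \<and> x \<in> carrier M \<and> y \<in> carrier N} \<union>
      {\<delta> x (r \<odot>\<^bsub>N\<^esub> y) \<ominus>\<^bsub>F\<^esub> r \<odot>\<^bsub>F\<^esub> \<delta> x y | r x y.
         r \<in> carrier R \<and> x \<in> carrier M \<and> y \<in> carrier N})"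

definition tensor_kernel ::
  "('k, 'r) ring_scheme \<Rightarrow> ('k, 'm, 'x) module_scheme \<Rightarrow> ('k, 'n, 'y) module_scheme \<Rightarrow>
   ('m \<times> 'n \<Rightarrow> 'k) set"
  where "tensor_kernel R M N =
    (\<lambda>H. submodule H R (free_module R (carrier M \<times> carrier N))) hull tensor_relators R M N"

definition tensor ::
  "('k, 'r) ring_scheme \<Rightarrow> ('k, 'm, 'x) module_scheme \<Rightarrow> ('k, 'n, 'y) module_scheme \<Rightarrow>
   ('k, ('m \<times> 'n \<Rightarrow> 'k) set) module"  (infixl \<open>\<boxtimes>\<index>\<close> 70)
  where "tensor R M N =
    quotient_module (free_module R (carrier M \<times> carrier N)) (tensor_kernel R M N)"

definition pure_tensor ::
  "('k, 'r) ring_scheme \<Rightarrow> ('k, 'm, 'x) module_scheme \<Rightarrow> ('k, 'n, 'y) module_scheme \<Rightarrow>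
   'm \<Rightarrow> 'n \<Rightarrow> ('m \<times> 'n \<Rightarrow> 'k) set"
  where "pure_tensor R M N x y =
    tensor_kernel R M N +>\<^bsub>free_module R (carrier M \<times> carrier N)\<^esub> free_gen R (x, y)"

text \<open>The linear map on \<open>M \<boxtimes>\<^bsub>R\<^esub> N\<close> induced by a bilinear map; existence and uniqueness
  are the universal property, theorem \<open>tensor_universal\<close> below.\<close>

definition tensor_lift ::
  "('k, 'r) ring_scheme \<Rightarrow> ('k, 'm, 'x) module_scheme \<Rightarrow> ('k, 'n, 'y) module_scheme \<Rightarrow>
   ('k, 'p, 'z) module_scheme \<Rightarrow> ('m \<Rightarrow> 'n \<Rightarrow> 'p) \<Rightarrow> ('m \<times> 'n \<Rightarrow> 'k) set \<Rightarrow> 'p"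
  where "tensor_lift R M N P f = (THE h.
     h \<in> module_hom R (M \<boxtimes>\<^bsub>R\<^esub> N) P \<inter> extensional (carrier (M \<boxtimes>\<^bsub>R\<^esub> N)) \<and>
     (\<forall>x\<in>carrier M. \<forall>y\<in>carrier N. h (pure_tensor R M N x y) = f x y))"

definition tensor_map ::
  "('k, 'r) ring_scheme \<Rightarrow> ('k, 'm, 'x) module_scheme \<Rightarrow> ('k, 'n, 'y) module_scheme \<Rightarrow>
   ('k, 'p, 'z) module_scheme \<Rightarrow> ('k, 'q, 'w) module_scheme \<Rightarrow>
   ('m \<Rightarrow> 'p) \<Rightarrow> ('n \<Rightarrow> 'q) \<Rightarrow> ('m \<times> 'n \<Rightarrow> 'k) set \<Rightarrow> ('p \<times> 'q \<Rightarrow> 'k) set"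
  where "tensor_map R M N P Q f g =
    tensor_lift R M N (P \<boxtimes>\<^bsub>R\<^esub> Q) (\<lambda>x y. pure_tensor R P Q (f x) (g y))"

definition tensor_assoc where
  "tensor_assoc R L M N =
    tensor_lift R (L \<boxtimes>\<^bsub>R\<^esub> M) N (L \<boxtimes>\<^bsub>R\<^esub> (M \<boxtimes>\<^bsub>R\<^esub> N)) (\<lambda>t z.
      tensor_lift R L M (L \<boxtimes>\<^bsub>R\<^esub> (M \<boxtimes>\<^bsub>R\<^esub> N)) (\<lambda>x y.
        pure_tensor R L (M \<boxtimes>\<^bsub>R\<^esub> N) x (pure_tensor R M N y z)) t)"

definition tensor_assoc_inv where
  "tensor_assoc_inv R L M N =
    tensor_lift R L (M \<boxtimes>\<^bsub>R\<^esub> N) (L \<boxtimes>\<^bsub>R\<^esub> M \<boxtimes>\<^bsub>R\<^esub> N) (\<lambda>x.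
      tensor_lift R M N (L \<boxtimes>\<^bsub>R\<^esub> M \<boxtimes>\<^bsub>R\<^esub> N) (\<lambda>y z.
        pure_tensor R (L \<boxtimes>\<^bsub>R\<^esub> M) N (pure_tensor R L M x y) z))"


section \<open>The universal property\<close>

context cring begin

lemma free_module_simps [simp]:
  "zero (free_module R S) = (\<lambda>s. \<zero>)"
  "add (free_module R S) = (\<lambda>u v s. u s \<oplus> v s)"
  "smult (free_module R S) = (\<lambda>r u s. r \<otimes> u s)"
  by (simp_all add: free_module_def)

lemma free_module_carrier_iff:
  "u \<in> carrier (free_module R S) \<longleftrightarrow>
     (\<forall>s. u s \<in> carrier R) \<and> (\<forall>s. s \<notin> S \<longrightarrow> u s = \<zero>) \<and> finite {s. u s \<noteq> \<zero>}"
  by (simp add: free_module_def)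

lemma module_free_module: "module R (free_module R S)"
proof (rule moduleI)
  let ?F = "free_module R S"
  have add: "u \<oplus>\<^bsub>?F\<^esub> v \<in> carrier ?F" if "u \<in> carrier ?F" "v \<in> carrier ?F" for u v
  proof -
    have "{s. u s \<oplus> v s \<noteq> \<zero>} \<subseteq> {s. u s \<noteq> \<zero>} \<union> {s. v s \<noteq> \<zero>}"
      using that by (auto simp: free_module_carrier_iff)
    then show ?thesis
      using that by (auto simp: free_module_carrier_iff intro: finite_subset)
  qed
  show "abelian_group ?F"
  proof (rule abelian_groupI)
    fix u assume u: "u \<in> carrier ?F"
    show "\<exists>v\<in>carrier ?F. v \<oplus>\<^bsub>?F\<^esub> u = \<zero>\<^bsub>?F\<^esub>"
    proof (rule bexI[of _ "\<lambda>s. \<ominus> u s"])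
      have "{s. \<ominus> u s \<noteq> \<zero>} \<subseteq> {s. u s \<noteq> \<zero>}" by auto
      then show "(\<lambda>s. \<ominus> u s) \<in> carrier ?F"
        using u by (auto simp: free_module_carrier_iff intro: finite_subset)
    qed (use u in \<open>auto simp: free_module_carrier_iff l_neg\<close>)
  qed (use add in \<open>auto simp: free_module_carrier_iff a_ac\<close>)
  fix r u assume r: "r \<in> carrier R" and u: "u \<in> carrier ?F"
  have "{s. r \<otimes> u s \<noteq> \<zero>} \<subseteq> {s. u s \<noteq> \<zero>}" using r by auto
  then show "r \<odot>\<^bsub>?F\<^esub> u \<in> carrier ?F"
    using r u by (auto simp: free_module_carrier_iff intro: finite_subset)
qed (auto simp: free_module_carrier_iff l_distr r_distr m_assoc is_cring)

lemma free_gen_closed: "s \<in> S \<Longrightarrow> free_gen R s \<in> carrier (free_module R S)"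
  by (auto simp: free_module_carrier_iff free_gen_def)

lemma free_module_induct [consumes 1, case_names zero gen add smult]:
  assumes "u \<in> carrier (free_module R S)"
    and zero: "P (\<lambda>s. \<zero>)"
    and gen: "\<And>s. s \<in> S \<Longrightarrow> P (free_gen R s)"
    and add: "\<And>u v. u \<in> carrier (free_module R S) \<Longrightarrow> v \<in> carrier (free_module R S) \<Longrightarrow>
      P u \<Longrightarrow> P v \<Longrightarrow> P (\<lambda>s. u s \<oplus> v s)"
    and smult: "\<And>r u. r \<in> carrier R \<Longrightarrow> u \<in> carrier (free_module R S) \<Longrightarrow> P u \<Longrightarrow>
      P (\<lambda>s. r \<otimes> u s)"
  shows "P u"
proof -
  interpret F: module R "free_module R S" by (rule module_free_module)
  have "finite E \<Longrightarrow> \<forall>u\<in>carrier (free_module R S). {s. u s \<noteq> \<zero>} \<subseteq> E \<longrightarrow> P u" for E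
  proof (induction E rule: finite_induct)
    case empty
    then show ?case using zero by (auto simp flip: fun_eq_iff)
  next
    case (insert x E)
    show ?case
    proof (intro ballI impI)
      fix u assume u: "u \<in> carrier (free_module R S)" and sub: "{s. u s \<noteq> \<zero>} \<subseteq> insert x E"
      define v where "v = (\<lambda>s. if s = x then \<zero> else u s)"
      have v: "v \<in> carrier (free_module R S)"
        using u by (auto simp: free_module_carrier_iff v_def intro: finite_subset[of _ "{s. u s \<noteq> \<zero>}"])
      have "{s. v s \<noteq> \<zero>} \<subseteq> E" using sub by (auto simp: v_def)
      then have "P v" using insert.IH v by blast
      show "P u"
      proof (cases "x \<in> S")
        case True
        have uc: "\<And>s. u s \<in> carrier R" using u by (simp add: free_module_carrier_iff)
        have eq: "u = (\<lambda>s. v s \<oplus> (u x \<otimes> free_gen R x s))"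
          using uc by (auto simp: v_def free_gen_def)
        have c: "(\<lambda>s. u x \<otimes> free_gen R x s) \<in> carrier (free_module R S)"
          using F.smult_closed[OF uc[of x] free_gen_closed[OF True]] by simp
        have "P (\<lambda>s. v s \<oplus> (u x \<otimes> free_gen R x s))"
          by (rule add[OF v c \<open>P v\<close> smult[OF uc free_gen_closed[OF True] gen[OF True]]])
        then show ?thesis using eq by simp
      next
        case False
        then have "u = v" using u by (auto simp: v_def free_module_carrier_iff)
        then show ?thesis using \<open>P v\<close> by simp
      qed
    qed
  qed
  then show ?thesis using assms(1) by (auto simp: free_module_carrier_iff)
qed

end

lemma (in module) module_quotient_module:
  assumes H: "submodule H R M"
  shows "module R (quotient_module M H)"
    and "\<And>x y. x \<in> carrier M \<Longrightarrow> y \<in> carrier M \<Longrightarrow>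
      (H +>\<^bsub>M\<^esub> x) \<oplus>\<^bsub>quotient_module M H\<^esub> (H +>\<^bsub>M\<^esub> y) = H +>\<^bsub>M\<^esub> (x \<oplus>\<^bsub>M\<^esub> y)"
    and "\<And>r x. r \<in> carrier R \<Longrightarrow> x \<in> carrier M \<Longrightarrow>
      r \<odot>\<^bsub>quotient_module M H\<^esub> (H +>\<^bsub>M\<^esub> x) = H +>\<^bsub>M\<^esub> (r \<odot>\<^bsub>M\<^esub> x)"
    and "carrier (quotient_module M H) = (\<lambda>x. H +>\<^bsub>M\<^esub> x) ` carrier M"
    and "\<And>x y. x \<in> carrier M \<Longrightarrow> y \<in> carrier M \<Longrightarrow>
      H +>\<^bsub>M\<^esub> x = H +>\<^bsub>M\<^esub> y \<longleftrightarrow> x \<ominus>\<^bsub>M\<^esub> y \<in> H"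
proof -
  let ?Q = "quotient_module M H"
  interpret H: submodule H R M by fact
  interpret H: additive_subgroup H M
    by (rule additive_subgroup.intro) (rule H.subgroup_axioms)
  interpret H: abelian_subgroup H M
    by (rule abelian_subgroupI3) (rule H.additive_subgroup_axioms, rule M.abelian_group_axioms)
  show car: "carrier ?Q = (\<lambda>x. H +>\<^bsub>M\<^esub> x) ` carrier M"
    by (auto simp: quotient_module_def A_RCOSETS_def')
  show eq: "H +>\<^bsub>M\<^esub> x = H +>\<^bsub>M\<^esub> y \<longleftrightarrow> x \<ominus>\<^bsub>M\<^esub> y \<in> H"
    if "x \<in> carrier M" "y \<in> carrier M" for x y
  proof -
    have "x \<in> H +>\<^bsub>M\<^esub> y \<longleftrightarrow> x \<ominus>\<^bsub>M\<^esub> y \<in> H"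
      using H.a_rcos_module[OF that(2,1)] by (simp add: a_minus_def)
    then show ?thesis
      by (metis H.a_rcos_self H.a_repr_independence' that)
  qed
  show add: "(H +>\<^bsub>M\<^esub> x) \<oplus>\<^bsub>?Q\<^esub> (H +>\<^bsub>M\<^esub> y) = H +>\<^bsub>M\<^esub> (x \<oplus>\<^bsub>M\<^esub> y)"
    if "x \<in> carrier M" "y \<in> carrier M" for x y
    using that by (simp add: quotient_module_def H.a_rcos_sum)
  show smult: "r \<odot>\<^bsub>?Q\<^esub> (H +>\<^bsub>M\<^esub> x) = H +>\<^bsub>M\<^esub> (r \<odot>\<^bsub>M\<^esub> x)"
    if r: "r \<in> carrier R" and x: "x \<in> carrier M" for r x
  proof -
    have "H +>\<^bsub>M\<^esub> (r \<odot>\<^bsub>M\<^esub> x') = H +>\<^bsub>M\<^esub> (r \<odot>\<^bsub>M\<^esub> x)" if x': "x' \<in> H +>\<^bsub>M\<^esub> x" for x'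
    proof -
      obtain h where h: "h \<in> H" "x' = h \<oplus>\<^bsub>M\<^esub> x" using x' by (auto simp: a_r_coset_def')
      then have hc: "h \<in> carrier M" using H.a_Hcarr by simp
      have "r \<odot>\<^bsub>M\<^esub> x' \<ominus>\<^bsub>M\<^esub> r \<odot>\<^bsub>M\<^esub> x = r \<odot>\<^bsub>M\<^esub> h"
        using r x hc by (simp add: h smult_r_distr M.minus_eq M.a_assoc M.r_neg)
      then show ?thesis using eq[of "r \<odot>\<^bsub>M\<^esub> x'" "r \<odot>\<^bsub>M\<^esub> x"] h hc r x by simp
    qed
    moreover have "x \<in> H +>\<^bsub>M\<^esub> x" using x by (rule H.a_rcos_self)
    ultimately have "(\<Union>x'\<in>H +>\<^bsub>M\<^esub> x. H +>\<^bsub>M\<^esub> (r \<odot>\<^bsub>M\<^esub> x')) = H +>\<^bsub>M\<^esub> (r \<odot>\<^bsub>M\<^esub> x)"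
      by blast
    then show ?thesis by (simp add: quotient_module_def)
  qed
  have zero: "\<zero>\<^bsub>?Q\<^esub> = H +>\<^bsub>M\<^esub> \<zero>\<^bsub>M\<^esub>"
    by (simp add: quotient_module_def H.a_subset)
  show "module R ?Q"
  proof (rule moduleI)
    show "abelian_group ?Q"
    proof (rule abelian_groupI)
      fix X assume "X \<in> carrier ?Q"
      then obtain x where x: "x \<in> carrier M" "X = H +>\<^bsub>M\<^esub> x" by (auto simp: car)
      show "\<exists>Y\<in>carrier ?Q. Y \<oplus>\<^bsub>?Q\<^esub> X = \<zero>\<^bsub>?Q\<^esub>"
        using x by (intro bexI[of _ "H +>\<^bsub>M\<^esub> (\<ominus>\<^bsub>M\<^esub> x)"]) (auto simp: car zero add M.l_neg)
    qed (auto simp: car zero add M.a_ac)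
  qed (auto simp: car add smult R.is_cring smult_l_distr smult_r_distr smult_assoc1)
qed

text \<open>\<open>lin_ext P f\<close> is the linear map on the free module that extends \<open>f\<close>.\<close>

definition (in cring) lin_ext :: "('a, 'p, 'z) module_scheme \<Rightarrow> ('s \<Rightarrow> 'p) \<Rightarrow> ('s \<Rightarrow> 'a) \<Rightarrow> 'p"
  where "lin_ext P f u = finsum P (\<lambda>s. u s \<odot>\<^bsub>P\<^esub> f s) {s. u s \<noteq> \<zero>}"

lemma (in cring) lin_ext:
  assumes P: "module R P" and f: "f \<in> S \<rightarrow> carrier P"
  shows lin_ext_hom: "lin_ext P f \<in> module_hom R (free_module R S) P"
    and lin_ext_gen: "\<And>s. s \<in> S \<Longrightarrow> lin_ext P f (free_gen R s) = f s"
proof -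
  interpret P: module R P by fact
  interpret F: module R "free_module R S" by (rule module_free_module)
  have fc: "f s \<in> carrier P" if "s \<in> S" for s using f that by auto
  have tc: "u s \<odot>\<^bsub>P\<^esub> f s \<in> carrier P" if "u \<in> carrier (free_module R S)" "s \<in> S" for u s
    using that fc by (auto simp: free_module_carrier_iff)
  have ext: "lin_ext P f u = finsum P (\<lambda>s. u s \<odot>\<^bsub>P\<^esub> f s) E"
    if u: "u \<in> carrier (free_module R S)" and E: "finite E" "{s. u s \<noteq> \<zero>} \<subseteq> E" "E \<subseteq> S" for u E
    unfolding lin_ext_def
    by (rule P.add.finprod_mono_neutral_cong_left) (use E tc u fc in auto)
  have supp: "finite {s. u s \<noteq> \<zero>}" "{s. u s \<noteq> \<zero>} \<subseteq> S" if "u \<in> carrier (free_module R S)" for u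
    using that by (auto simp: free_module_carrier_iff)
  have "lin_ext P f (u \<oplus>\<^bsub>free_module R S\<^esub> v) = lin_ext P f u \<oplus>\<^bsub>P\<^esub> lin_ext P f v"
    if u: "u \<in> carrier (free_module R S)" and v: "v \<in> carrier (free_module R S)" for u v
  proof -
    define E where "E = {s. u s \<noteq> \<zero>} \<union> {s. v s \<noteq> \<zero>}"
    have E: "finite E" "E \<subseteq> S" "{s. u s \<noteq> \<zero>} \<subseteq> E" "{s. v s \<noteq> \<zero>} \<subseteq> E"
      using supp[OF u] supp[OF v] by (auto simp: E_def)
    have w: "u \<oplus>\<^bsub>free_module R S\<^esub> v \<in> carrier (free_module R S)" using u v by (rule F.M.a_closed)
    have wE: "{s. (u \<oplus>\<^bsub>free_module R S\<^esub> v) s \<noteq> \<zero>} \<subseteq> E" by (auto simp: E_def)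
    have uc: "u s \<in> carrier R" and vc: "v s \<in> carrier R" for s
      using u v by (auto simp: free_module_carrier_iff)
    have fE: "f s \<in> carrier P" if "s \<in> E" for s using fc E(2) that by auto
    have "lin_ext P f (u \<oplus>\<^bsub>free_module R S\<^esub> v) =
        finsum P (\<lambda>s. u s \<odot>\<^bsub>P\<^esub> f s \<oplus>\<^bsub>P\<^esub> v s \<odot>\<^bsub>P\<^esub> f s) E"
      unfolding ext[OF w E(1) wE E(2)]
      by (rule P.M.finsum_cong') (auto simp: P.smult_l_distr uc vc fE)
    also have "\<dots> = lin_ext P f u \<oplus>\<^bsub>P\<^esub> lin_ext P f v"
      unfolding ext[OF u E(1,3,2)] ext[OF v E(1,4,2)]
      by (rule P.M.finsum_addf) (auto simp: uc vc fE)
    finally show ?thesis .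
  qed
  moreover have "lin_ext P f (r \<odot>\<^bsub>free_module R S\<^esub> u) = r \<odot>\<^bsub>P\<^esub> lin_ext P f u"
    if r: "r \<in> carrier R" and u: "u \<in> carrier (free_module R S)" for r u
  proof -
    have w: "r \<odot>\<^bsub>free_module R S\<^esub> u \<in> carrier (free_module R S)" using r u by (rule F.smult_closed)
    have wE: "{s. (r \<odot>\<^bsub>free_module R S\<^esub> u) s \<noteq> \<zero>} \<subseteq> {s. u s \<noteq> \<zero>}" using r by auto
    have uc: "u s \<in> carrier R" for s
      using u by (auto simp: free_module_carrier_iff)
    have fE: "f s \<in> carrier P" if "u s \<noteq> \<zero>" for s using fc supp(2)[OF u] that by auto
    have "lin_ext P f (r \<odot>\<^bsub>free_module R S\<^esub> u) =
        finsum P (\<lambda>s. r \<odot>\<^bsub>P\<^esub> (u s \<odot>\<^bsub>P\<^esub> f s)) {s. u s \<noteq> \<zero>}"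
      unfolding ext[OF w supp(1)[OF u] wE supp(2)[OF u]]
      by (rule P.M.finsum_cong') (auto simp: P.smult_assoc1 uc r fE)
    also have "\<dots> = r \<odot>\<^bsub>P\<^esub> lin_ext P f u"
      unfolding lin_ext_def
      by (rule P.finsum_smult_ldistr[symmetric]) (auto simp: uc r fE supp(1)[OF u])
    finally show ?thesis .
  qed
  moreover have "lin_ext P f u \<in> carrier P" if u: "u \<in> carrier (free_module R S)" for u
    unfolding lin_ext_def by (rule P.M.finsum_closed) (use u supp[OF u] tc in auto)
  ultimately show "lin_ext P f \<in> module_hom R (free_module R S) P"
    by (auto simp: module_hom_def)
  show "lin_ext P f (free_gen R s) = f s" if s: "s \<in> S" for s
  proof -
    have "lin_ext P f (free_gen R s) = finsum P (\<lambda>t. free_gen R s t \<odot>\<^bsub>P\<^esub> f t) {s}"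
      by (rule ext[OF free_gen_closed[OF s]]) (use s in \<open>auto simp: free_gen_def\<close>)
    also have "\<dots> = f s" using fc[OF s] by (simp add: free_gen_def)
    finally show ?thesis .
  qed
qed

lemma module_homD:
  assumes "h \<in> module_hom R M N"
  shows module_hom_closed: "x \<in> carrier M \<Longrightarrow> h x \<in> carrier N"
    and module_hom_add: "x \<in> carrier M \<Longrightarrow> y \<in> carrier M \<Longrightarrow> h (x \<oplus>\<^bsub>M\<^esub> y) = h x \<oplus>\<^bsub>N\<^esub> h y"
    and module_hom_smult: "r \<in> carrier R \<Longrightarrow> x \<in> carrier M \<Longrightarrow> h (r \<odot>\<^bsub>M\<^esub> x) = r \<odot>\<^bsub>N\<^esub> h x"
  using assms by (auto simp: module_hom_def)

lemma module_hom_minus: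
  assumes "module R M" "module R N" "h \<in> module_hom R M N" "x \<in> carrier M" "y \<in> carrier M"
  shows "h (x \<ominus>\<^bsub>M\<^esub> y) = h x \<ominus>\<^bsub>N\<^esub> h y"
proof -
  interpret M: module R M by fact
  interpret N: module R N by fact
  note h = module_homD[OF assms(3)]
  have "h (x \<ominus>\<^bsub>M\<^esub> y) \<oplus>\<^bsub>N\<^esub> h y = h x"
    using assms(4,5) by (simp add: a_minus_def M.M.a_assoc M.M.l_neg flip: h(2))
  then show ?thesis
    using assms(4,5) h(1)
    by (metis M.M.minus_closed N.M.add.inv_solve_right a_minus_def)
qed

locale tensor_pair = M: module R M + N: module R N
  for R (structure) and M (structure) and N (structure)
begin

abbreviation "F \<equiv> free_module R (carrier M \<times> carrier N)"
abbreviation "K \<equiv> tensor_kernel R M N"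
abbreviation "pt \<equiv> pure_tensor R M N"

sublocale F: module R F by (rule M.module_free_module)

lemma relators:
  "\<lbrakk>x \<in> carrier M; x' \<in> carrier M; y \<in> carrier N\<rbrakk> \<Longrightarrow>
    free_gen R (x \<oplus>\<^bsub>M\<^esub> x', y) \<ominus>\<^bsub>F\<^esub> (free_gen R (x, y) \<oplus>\<^bsub>F\<^esub> free_gen R (x', y))
      \<in> tensor_relators R M N"
  "\<lbrakk>x \<in> carrier M; y \<in> carrier N; y' \<in> carrier N\<rbrakk> \<Longrightarrow>
    free_gen R (x, y \<oplus>\<^bsub>N\<^esub> y') \<ominus>\<^bsub>F\<^esub> (free_gen R (x, y) \<oplus>\<^bsub>F\<^esub> free_gen R (x, y'))
      \<in> tensor_relators R M N"
  "\<lbrakk>r \<in> carrier R; x \<in> carrier M; y \<in> carrier N\<rbrakk> \<Longrightarrow>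
    free_gen R (r \<odot>\<^bsub>M\<^esub> x, y) \<ominus>\<^bsub>F\<^esub> r \<odot>\<^bsub>F\<^esub> free_gen R (x, y) \<in> tensor_relators R M N"
  "\<lbrakk>r \<in> carrier R; x \<in> carrier M; y \<in> carrier N\<rbrakk> \<Longrightarrow>
    free_gen R (x, r \<odot>\<^bsub>N\<^esub> y) \<ominus>\<^bsub>F\<^esub> r \<odot>\<^bsub>F\<^esub> free_gen R (x, y) \<in> tensor_relators R M N"
  unfolding tensor_relators_def Let_def by blast+

lemma relators_subset: "tensor_relators R M N \<subseteq> carrier F"
  unfolding tensor_relators_def Let_def
  by (intro Un_least subsetI; elim CollectE exE conjE; hypsubst;
      intro F.M.minus_closed F.M.a_closed F.smult_closed M.free_gen_closed SigmaI
        M.M.a_closed N.M.a_closed M.smult_closed N.smult_closed; assumption)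

lemma submodule_Inter:
  assumes "\<And>H. H \<in> C \<Longrightarrow> submodule H R F" "C \<noteq> {}"
  shows "submodule (\<Inter>C) R F"
proof (rule F.submoduleI)
  note E = F.submoduleE[OF assms(1)]
  show "\<Inter>C \<subseteq> carrier F" using E(1) assms(2) by blast
  have "\<zero>\<^bsub>F\<^esub> \<in> H" if "H \<in> C" for H
    using subgroup.one_closed[OF submodule.axioms(1)[OF assms(1)[OF that]]] by simp
  then show "\<zero>\<^bsub>F\<^esub> \<in> \<Inter>C" by blast
  show "\<ominus>\<^bsub>F\<^esub> a \<in> \<Inter>C" if "a \<in> \<Inter>C" for a using E(3) that by blast
  show "a \<oplus>\<^bsub>F\<^esub> b \<in> \<Inter>C" if "a \<in> \<Inter>C" "b \<in> \<Inter>C" for a b using E(5) that by blast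
  show "a \<odot>\<^bsub>F\<^esub> x \<in> \<Inter>C" if "a \<in> carrier R" "x \<in> \<Inter>C" for a x using E(4) that by blast
qed

lemma kernel_submodule: "submodule K R F"
  unfolding tensor_kernel_def hull_def
proof (rule submodule_Inter)
  show "{H. submodule H R F \<and> tensor_relators R M N \<subseteq> H} \<noteq> {}"
    using F.carrier_is_submodule relators_subset by blast
qed blast

lemma relators_kernel: "tensor_relators R M N \<subseteq> K"
  unfolding tensor_kernel_def by (rule hull_subset)

lemma kernel_least: "submodule H R F \<Longrightarrow> tensor_relators R M N \<subseteq> H \<Longrightarrow> K \<subseteq> H"
  unfolding tensor_kernel_def by (rule hull_minimal)

lemmas Q = F.module_quotient_module[OF kernel_submodule, folded tensor_def]

lemma module_tensor: "module R (M \<boxtimes> N)"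
  by (rule Q(1))

lemma pt_closed: "x \<in> carrier M \<Longrightarrow> y \<in> carrier N \<Longrightarrow> pt x y \<in> carrier (M \<boxtimes> N)"
  unfolding Q(4) pure_tensor_def by (auto intro: M.free_gen_closed)

lemma pt_bilinear: "pt \<in> bilinear_maps R M N (M \<boxtimes> N)"
proof -
  have g: "free_gen R (x, y) \<in> carrier F" if "x \<in> carrier M" "y \<in> carrier N" for x y
    using that by (intro M.free_gen_closed) auto
  note [simp del] = M.free_module_simps
  have "pt (x \<oplus>\<^bsub>M\<^esub> x') y = pt x y \<oplus>\<^bsub>M \<boxtimes> N\<^esub> pt x' y"
    if *: "x \<in> carrier M" "x' \<in> carrier M" "y \<in> carrier N" for x x' y
    unfolding pure_tensor_def
    by (subst Q(2)[OF g[OF *(1,3)] g[OF *(2,3)]], subst Q(5))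
      (intro g F.M.a_closed M.M.a_closed N.M.a_closed F.smult_closed M.smult_closed
        N.smult_closed subsetD[OF relators_kernel] relators *)+
  moreover have "pt x (y \<oplus>\<^bsub>N\<^esub> y') = pt x y \<oplus>\<^bsub>M \<boxtimes> N\<^esub> pt x y'"
    if *: "x \<in> carrier M" "y \<in> carrier N" "y' \<in> carrier N" for x y y'
    unfolding pure_tensor_def
    by (subst Q(2)[OF g[OF *(1,2)] g[OF *(1,3)]], subst Q(5))
      (intro g F.M.a_closed M.M.a_closed N.M.a_closed F.smult_closed M.smult_closed
        N.smult_closed subsetD[OF relators_kernel] relators *)+
  moreover have "pt (r \<odot>\<^bsub>M\<^esub> x) y = r \<odot>\<^bsub>M \<boxtimes> N\<^esub> pt x y"
    if *: "r \<in> carrier R" "x \<in> carrier M" "y \<in> carrier N" for r x y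
    unfolding pure_tensor_def
    by (subst Q(3)[OF *(1) g[OF *(2,3)]], subst Q(5))
      (intro g F.M.a_closed M.M.a_closed N.M.a_closed F.smult_closed M.smult_closed
        N.smult_closed subsetD[OF relators_kernel] relators *)+
  moreover have "pt x (r \<odot>\<^bsub>N\<^esub> y) = r \<odot>\<^bsub>M \<boxtimes> N\<^esub> pt x y"
    if *: "r \<in> carrier R" "x \<in> carrier M" "y \<in> carrier N" for r x y
    unfolding pure_tensor_def
    by (subst Q(3)[OF *(1) g[OF *(2,3)]], subst Q(5))
      (intro g F.M.a_closed M.M.a_closed N.M.a_closed F.smult_closed M.smult_closed
        N.smult_closed subsetD[OF relators_kernel] relators *)+
  ultimately show ?thesis
    using pt_closed by (auto simp: bilinear_maps_def module_hom_def)
qed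

lemma tensor_induct [consumes 1, case_names pure add smult]:
  assumes "t \<in> carrier (M \<boxtimes> N)"
    and pure: "\<And>x y. x \<in> carrier M \<Longrightarrow> y \<in> carrier N \<Longrightarrow> P (pt x y)"
    and add: "\<And>s t. s \<in> carrier (M \<boxtimes> N) \<Longrightarrow> t \<in> carrier (M \<boxtimes> N) \<Longrightarrow> P s \<Longrightarrow> P t \<Longrightarrow>
      P (s \<oplus>\<^bsub>M \<boxtimes> N\<^esub> t)"
    and smult: "\<And>r t. r \<in> carrier R \<Longrightarrow> t \<in> carrier (M \<boxtimes> N) \<Longrightarrow> P t \<Longrightarrow> P (r \<odot>\<^bsub>M \<boxtimes> N\<^esub> t)"
  shows "P t"
proof -
  obtain u where u: "u \<in> carrier F" "t = K +>\<^bsub>F\<^esub> u" using assms(1) by (auto simp: Q(4))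
  have c: "K +>\<^bsub>F\<^esub> v \<in> carrier (M \<boxtimes> N)" if "v \<in> carrier F" for v using that by (simp add: Q(4))
  have "P (K +>\<^bsub>F\<^esub> u)" using u(1)
  proof (induction u rule: M.free_module_induct)
    case zero
    interpret T: module R "M \<boxtimes> N" by (rule module_tensor)
    have "P (\<zero> \<odot>\<^bsub>M \<boxtimes> N\<^esub> pt \<zero>\<^bsub>M\<^esub> \<zero>\<^bsub>N\<^esub>)" by (intro smult pure pt_closed) auto
    moreover have "\<zero> \<odot>\<^bsub>M \<boxtimes> N\<^esub> pt \<zero>\<^bsub>M\<^esub> \<zero>\<^bsub>N\<^esub> = K +>\<^bsub>F\<^esub> (\<zero> \<odot>\<^bsub>F\<^esub> free_gen R (\<zero>\<^bsub>M\<^esub>, \<zero>\<^bsub>N\<^esub>))"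
      unfolding pure_tensor_def by (rule Q(3)) (auto intro!: M.free_gen_closed)
    moreover have "\<zero> \<odot>\<^bsub>F\<^esub> free_gen R (\<zero>\<^bsub>M\<^esub>, \<zero>\<^bsub>N\<^esub>) = (\<lambda>s. \<zero>)"
      by (auto simp: free_gen_def)
    ultimately show ?case by simp
  next
    case (gen s)
    then show ?case using pure by (auto simp: pure_tensor_def)
  next
    case (add u v)
    have "P ((K +>\<^bsub>F\<^esub> u) \<oplus>\<^bsub>M \<boxtimes> N\<^esub> (K +>\<^bsub>F\<^esub> v))"
      using add by (intro assms(3) c)
    then show ?case using Q(2)[of u v] add by simp
  next
    case (smult r u)
    have "P (r \<odot>\<^bsub>M \<boxtimes> N\<^esub> (K +>\<^bsub>F\<^esub> u))"
      using smult by (intro assms(4) c)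
    then show ?case using Q(3)[of r u] smult by simp
  qed
  then show ?thesis using u by simp
qed

theorem tensor_universal:
  assumes P: "module R P" and f: "f \<in> bilinear_maps R M N P"
  shows "\<exists>!h. h \<in> module_hom R (M \<boxtimes> N) P \<inter> extensional (carrier (M \<boxtimes> N)) \<and>
    (\<forall>x\<in>carrier M. \<forall>y\<in>carrier N. h (pt x y) = f x y)"
proof (rule ex_ex1I)
  interpret P: module R P by fact
  note fl = bspec[OF conjunct1[OF f[unfolded bilinear_maps_def mem_Collect_eq]]]
  note fr = bspec[OF conjunct2[OF f[unfolded bilinear_maps_def mem_Collect_eq]]]
  define \<phi> where "\<phi> = M.lin_ext P (\<lambda>(x, y). f x y)"
  have f0: "(\<lambda>(x, y). f x y) \<in> carrier M \<times> carrier N \<rightarrow> carrier P"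
    using module_hom_closed[OF fl] by auto
  have \<phi>: "\<phi> \<in> module_hom R F P" unfolding \<phi>_def by (rule M.lin_ext_hom[OF P f0])
  have \<phi>g: "\<phi> (free_gen R (x, y)) = f x y" if "x \<in> carrier M" "y \<in> carrier N" for x y
    unfolding \<phi>_def using M.lin_ext_gen[OF P f0, of "(x, y)"] that by simp
  note h = module_homD[OF \<phi>] and hm = module_hom_minus[OF F.module_axioms P \<phi>]
  note [simp del] = M.free_module_simps
  have g: "free_gen R (x, y) \<in> carrier F" if "x \<in> carrier M" "y \<in> carrier N" for x y
    using that by (intro M.free_gen_closed) auto
  have fc: "f x y \<in> carrier P" if "x \<in> carrier M" "y \<in> carrier N" for x y
    using module_hom_closed[OF fl] that by auto
  define H where "H = {u \<in> carrier F. \<phi> u = \<zero>\<^bsub>P\<^esub>}"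
  have z: "\<phi> \<zero>\<^bsub>F\<^esub> = \<zero>\<^bsub>P\<^esub>"
    using h(3)[of \<zero> "\<zero>\<^bsub>F\<^esub>"] h(1) by simp
  have neg: "\<phi> (\<ominus>\<^bsub>F\<^esub> u) = \<ominus>\<^bsub>P\<^esub> \<phi> u" if "u \<in> carrier F" for u
    using hm[of "\<zero>\<^bsub>F\<^esub>" u] that h(1) by (simp add: a_minus_def z)
  have self: "p \<ominus>\<^bsub>P\<^esub> p = \<zero>\<^bsub>P\<^esub>" if "p \<in> carrier P" for p
    using that by (simp add: a_minus_def P.M.r_neg)
  have "submodule H R F"
    by (rule F.submoduleI) (auto simp: H_def h(2,3) z neg)
  moreover have "tensor_relators R M N \<subseteq> H"
  proof
    fix u assume u: "u \<in> tensor_relators R M N"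
    then have uc: "u \<in> carrier F" using relators_subset by auto
    have "\<phi> u = \<zero>\<^bsub>P\<^esub>"
      using u unfolding tensor_relators_def Let_def
      by (auto simp: hm h(2,3) g \<phi>g fc module_hom_add[OF fl] module_hom_smult[OF fl]
          module_hom_add[OF fr] module_hom_smult[OF fr] self)
    then show "u \<in> H" using uc by (simp add: H_def)
  qed
  ultimately have K: "K \<subseteq> H" by (rule kernel_least)
  define h' where "h' = restrict (\<lambda>X. the_elem (\<phi> ` X)) (carrier (M \<boxtimes> N))"
  have h': "h' (K +>\<^bsub>F\<^esub> u) = \<phi> u" if u: "u \<in> carrier F" for u
  proof -
    have Kc: "K \<subseteq> carrier F" using K by (auto simp: H_def)
    have "\<zero>\<^bsub>F\<^esub> \<in> K" 
      using subgroup.one_closed[OF submodule.axioms(1)[OF kernel_submodule]] by simp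
    moreover have \<phi>K: "\<phi> (k \<oplus>\<^bsub>F\<^esub> u) = \<phi> u" if "k \<in> K" for k
      using that u K h by (auto simp: H_def)
    moreover have "\<phi> ` (K +>\<^bsub>F\<^esub> u) = (\<lambda>k. \<phi> (k \<oplus>\<^bsub>F\<^esub> u)) ` K"
      unfolding a_r_coset_def' by blast
    moreover have "(\<lambda>k. \<phi> (k \<oplus>\<^bsub>F\<^esub> u)) ` K = (\<lambda>k. \<phi> u) ` K"
      by (rule image_cong[OF refl \<phi>K])
    ultimately have "\<phi> ` (K +>\<^bsub>F\<^esub> u) = {\<phi> u}" by (simp only: image_constant)
    then show ?thesis using u by (simp add: h'_def Q(4))
  qed
  show "\<exists>h. h \<in> module_hom R (M \<boxtimes> N) P \<inter> extensional (carrier (M \<boxtimes> N)) \<and>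
    (\<forall>x\<in>carrier M. \<forall>y\<in>carrier N. h (pt x y) = f x y)"
  proof (intro exI conjI ballI IntI)
    show "h' \<in> module_hom R (M \<boxtimes> N) P"
      unfolding module_hom_def
      by (auto simp: Q(4) Q(2) Q(3) h' h)
    show "h' \<in> extensional (carrier (M \<boxtimes> N))" by (simp add: h'_def)
    show "h' (pt x y) = f x y" if "x \<in> carrier M" "y \<in> carrier N" for x y
      using that by (simp add: pure_tensor_def h' g \<phi>g)
  qed
next
  fix h h' assume h: "h \<in> module_hom R (M \<boxtimes> N) P \<inter> extensional (carrier (M \<boxtimes> N)) \<and>
      (\<forall>x\<in>carrier M. \<forall>y\<in>carrier N. h (pt x y) = f x y)"
    and h': "h' \<in> module_hom R (M \<boxtimes> N) P \<inter> extensional (carrier (M \<boxtimes> N)) \<and>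
      (\<forall>x\<in>carrier M. \<forall>y\<in>carrier N. h' (pt x y) = f x y)"
  then have hh: "h \<in> module_hom R (M \<boxtimes> N) P" "h' \<in> module_hom R (M \<boxtimes> N) P" by auto
  have "h t = h' t" if "t \<in> carrier (M \<boxtimes> N)" for t
    using that
    by (induction t rule: tensor_induct)
      (use h h' in \<open>auto simp: module_homD[OF hh(1)] module_homD[OF hh(2)]\<close>)
  then show "h = h'" using h h' by (intro extensionalityI[of _ "carrier (M \<boxtimes> N)"]) auto
qed

lemma tensor_lift:
  assumes "module R P" "f \<in> bilinear_maps R M N P"
  shows tensor_lift_hom: "tensor_lift R M N P f \<in> module_hom R (M \<boxtimes> N) P"
    and tensor_lift_pure: "\<And>x y. x \<in> carrier M \<Longrightarrow> y \<in> carrier N \<Longrightarrow>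
      tensor_lift R M N P f (pt x y) = f x y"
  using theI'[OF tensor_universal[OF assms]] unfolding tensor_lift_def by auto

end

lemma bilinear_mapsI:
  assumes "\<And>x y. x \<in> carrier M \<Longrightarrow> y \<in> carrier N \<Longrightarrow> f x y \<in> carrier P"
    and "\<And>x x' y. x \<in> carrier M \<Longrightarrow> x' \<in> carrier M \<Longrightarrow> y \<in> carrier N \<Longrightarrow>
      f (x \<oplus>\<^bsub>M\<^esub> x') y = f x y \<oplus>\<^bsub>P\<^esub> f x' y"
    and "\<And>x y y'. x \<in> carrier M \<Longrightarrow> y \<in> carrier N \<Longrightarrow> y' \<in> carrier N \<Longrightarrow>
      f x (y \<oplus>\<^bsub>N\<^esub> y') = f x y \<oplus>\<^bsub>P\<^esub> f x y'"
    and "\<And>r x y. r \<in> carrier R \<Longrightarrow> x \<in> carrier M \<Longrightarrow> y \<in> carrier N \<Longrightarrow>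
      f (r \<odot>\<^bsub>M\<^esub> x) y = r \<odot>\<^bsub>P\<^esub> f x y"
    and "\<And>r x y. r \<in> carrier R \<Longrightarrow> x \<in> carrier M \<Longrightarrow> y \<in> carrier N \<Longrightarrow>
      f x (r \<odot>\<^bsub>N\<^esub> y) = r \<odot>\<^bsub>P\<^esub> f x y"
  shows "f \<in> bilinear_maps R M N P"
  using assms by (auto simp: bilinear_maps_def module_hom_def)

lemma bilinear_mapsD:
  assumes "f \<in> bilinear_maps R M N P"
  shows "x \<in> carrier M \<Longrightarrow> y \<in> carrier N \<Longrightarrow> f x y \<in> carrier P"
    and "x \<in> carrier M \<Longrightarrow> x' \<in> carrier M \<Longrightarrow> y \<in> carrier N \<Longrightarrow>
      f (x \<oplus>\<^bsub>M\<^esub> x') y = f x y \<oplus>\<^bsub>P\<^esub> f x' y"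
    and "x \<in> carrier M \<Longrightarrow> y \<in> carrier N \<Longrightarrow> y' \<in> carrier N \<Longrightarrow>
      f x (y \<oplus>\<^bsub>N\<^esub> y') = f x y \<oplus>\<^bsub>P\<^esub> f x y'"
    and "r \<in> carrier R \<Longrightarrow> x \<in> carrier M \<Longrightarrow> y \<in> carrier N \<Longrightarrow>
      f (r \<odot>\<^bsub>M\<^esub> x) y = r \<odot>\<^bsub>P\<^esub> f x y"
    and "r \<in> carrier R \<Longrightarrow> x \<in> carrier M \<Longrightarrow> y \<in> carrier N \<Longrightarrow>
      f x (r \<odot>\<^bsub>N\<^esub> y) = r \<odot>\<^bsub>P\<^esub> f x y"
  using assms by (auto simp: bilinear_maps_def module_hom_def)

lemma tensor_map:
  assumes "module R M" "module R N" "module R P" "module R Q"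
    and f: "f \<in> module_hom R M P" and g: "g \<in> module_hom R N Q"
  shows tensor_map_hom: "tensor_map R M N P Q f g \<in> module_hom R (M \<boxtimes>\<^bsub>R\<^esub> N) (P \<boxtimes>\<^bsub>R\<^esub> Q)"
    and tensor_map_pure: "\<And>x y. x \<in> carrier M \<Longrightarrow> y \<in> carrier N \<Longrightarrow>
      tensor_map R M N P Q f g (pure_tensor R M N x y) = pure_tensor R P Q (f x) (g y)"
proof -
  interpret MN: tensor_pair R M N using assms by (intro tensor_pair.intro)
  interpret PQ: tensor_pair R P Q using assms by (intro tensor_pair.intro)
  have b: "(\<lambda>x y. pure_tensor R P Q (f x) (g y)) \<in> bilinear_maps R M N (P \<boxtimes>\<^bsub>R\<^esub> Q)"
    by (rule bilinear_mapsI)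
      (simp_all add: module_homD[OF f] module_homD[OF g] bilinear_mapsD[OF PQ.pt_bilinear])
  show "tensor_map R M N P Q f g \<in> module_hom R (M \<boxtimes>\<^bsub>R\<^esub> N) (P \<boxtimes>\<^bsub>R\<^esub> Q)"
    and "\<And>x y. x \<in> carrier M \<Longrightarrow> y \<in> carrier N \<Longrightarrow>
      tensor_map R M N P Q f g (pure_tensor R M N x y) = pure_tensor R P Q (f x) (g y)"
    unfolding tensor_map_def
    using MN.tensor_lift_hom[OF PQ.module_tensor b] MN.tensor_lift_pure[OF PQ.module_tensor b] by auto
qed

lemma tensor_assoc:
  assumes "module R L" "module R M" "module R N"
  shows tensor_assoc_hom: "tensor_assoc R L M N \<in>
      module_hom R (L \<boxtimes>\<^bsub>R\<^esub> M \<boxtimes>\<^bsub>R\<^esub> N) (L \<boxtimes>\<^bsub>R\<^esub> (M \<boxtimes>\<^bsub>R\<^esub> N))"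
    and tensor_assoc_pure: "\<And>x y z. x \<in> carrier L \<Longrightarrow> y \<in> carrier M \<Longrightarrow> z \<in> carrier N \<Longrightarrow>
      tensor_assoc R L M N (pure_tensor R (L \<boxtimes>\<^bsub>R\<^esub> M) N (pure_tensor R L M x y) z) =
      pure_tensor R L (M \<boxtimes>\<^bsub>R\<^esub> N) x (pure_tensor R M N y z)"
proof -
  interpret LM: tensor_pair R L M using assms by (intro tensor_pair.intro)
  interpret MN: tensor_pair R M N using assms by (intro tensor_pair.intro)
  interpret LM_N: tensor_pair R "L \<boxtimes>\<^bsub>R\<^esub> M" N
    using assms LM.module_tensor by (intro tensor_pair.intro)
  interpret L_MN: tensor_pair R L "M \<boxtimes>\<^bsub>R\<^esub> N"
    using assms MN.module_tensor by (intro tensor_pair.intro)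
  interpret T: module R "L \<boxtimes>\<^bsub>R\<^esub> (M \<boxtimes>\<^bsub>R\<^esub> N)" by (rule L_MN.module_tensor)
  define g where "g z x y = pure_tensor R L (M \<boxtimes>\<^bsub>R\<^esub> N) x (pure_tensor R M N y z)" for z x y
  have g: "g z \<in> bilinear_maps R L M (L \<boxtimes>\<^bsub>R\<^esub> (M \<boxtimes>\<^bsub>R\<^esub> N))" if "z \<in> carrier N" for z
    unfolding g_def using that
    by (intro bilinear_mapsI)
      (simp_all add: bilinear_mapsD[OF L_MN.pt_bilinear] bilinear_mapsD[OF MN.pt_bilinear])
  have g_add: "g (z \<oplus>\<^bsub>N\<^esub> z') x y = g z x y \<oplus>\<^bsub>L \<boxtimes>\<^bsub>R\<^esub> (M \<boxtimes>\<^bsub>R\<^esub> N)\<^esub> g z' x y"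
    if "x \<in> carrier L" "y \<in> carrier M" "z \<in> carrier N" "z' \<in> carrier N" for x y z z'
    using that by (simp add: g_def bilinear_mapsD[OF L_MN.pt_bilinear] bilinear_mapsD[OF MN.pt_bilinear])
  have g_smult: "g (r \<odot>\<^bsub>N\<^esub> z) x y = r \<odot>\<^bsub>L \<boxtimes>\<^bsub>R\<^esub> (M \<boxtimes>\<^bsub>R\<^esub> N)\<^esub> g z x y"
    if "r \<in> carrier R" "x \<in> carrier L" "y \<in> carrier M" "z \<in> carrier N" for r x y z
    using that by (simp add: g_def bilinear_mapsD[OF L_MN.pt_bilinear] bilinear_mapsD[OF MN.pt_bilinear])
  note gh = LM.tensor_lift_hom[OF T.module_axioms g] and gp = LM.tensor_lift_pure[OF T.module_axioms g]
  note gD = module_homD[OF gh]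
  let ?k = "\<lambda>t z. tensor_lift R L M (L \<boxtimes>\<^bsub>R\<^esub> (M \<boxtimes>\<^bsub>R\<^esub> N)) (g z) t"
  have b: "?k \<in> bilinear_maps R (L \<boxtimes>\<^bsub>R\<^esub> M) N (L \<boxtimes>\<^bsub>R\<^esub> (M \<boxtimes>\<^bsub>R\<^esub> N))"
  proof (rule bilinear_mapsI)
    fix t z z' assume t: "t \<in> carrier (L \<boxtimes>\<^bsub>R\<^esub> M)" and z: "z \<in> carrier N" "z' \<in> carrier N"
    have zz: "z \<oplus>\<^bsub>N\<^esub> z' \<in> carrier N" using z by simp
    show "?k t (z \<oplus>\<^bsub>N\<^esub> z') = ?k t z \<oplus>\<^bsub>L \<boxtimes>\<^bsub>R\<^esub> (M \<boxtimes>\<^bsub>R\<^esub> N)\<^esub> ?k t z'"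
      using t
    proof (induction t rule: LM.tensor_induct)
      case (pure x y)
      then show ?case using z
        by (simp add: gp[OF zz] gp[OF z(1)] gp[OF z(2)] g_add)
    next
      case (add s t)
      then show ?case by (simp add: gD[OF zz] gD[OF z(1)] gD[OF z(2)] T.M.a_ac)
    next
      case (smult r t)
      then show ?case by (simp add: gD[OF zz] gD[OF z(1)] gD[OF z(2)] T.smult_r_distr)
    qed
  next
    fix r t z assume r: "r \<in> carrier R" and t: "t \<in> carrier (L \<boxtimes>\<^bsub>R\<^esub> M)" and z: "z \<in> carrier N"
    have rz: "r \<odot>\<^bsub>N\<^esub> z \<in> carrier N" using r z by simp
    show "?k t (r \<odot>\<^bsub>N\<^esub> z) = r \<odot>\<^bsub>L \<boxtimes>\<^bsub>R\<^esub> (M \<boxtimes>\<^bsub>R\<^esub> N)\<^esub> ?k t z"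
      using t
    proof (induction t rule: LM.tensor_induct)
      case (pure x y)
      then show ?case using r z
        by (simp add: gp[OF rz] gp[OF z] g_smult)
    next
      case (add s t)
      then show ?case using r by (simp add: gD[OF rz] gD[OF z] T.smult_r_distr)
    next
      case (smult r' t)
      then show ?case using r
        by (simp add: gD[OF rz] gD[OF z] LM.M.m_comm flip: T.smult_assoc1)
    qed
  qed (simp_all add: gD)
  show "tensor_assoc R L M N \<in> module_hom R (L \<boxtimes>\<^bsub>R\<^esub> M \<boxtimes>\<^bsub>R\<^esub> N) (L \<boxtimes>\<^bsub>R\<^esub> (M \<boxtimes>\<^bsub>R\<^esub> N))"
    using LM_N.tensor_lift_hom[OF T.module_axioms b] by (simp add: tensor_assoc_def g_def[abs_def])
  show "tensor_assoc R L M N (pure_tensor R (L \<boxtimes>\<^bsub>R\<^esub> M) N (pure_tensor R L M x y) z) =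
      pure_tensor R L (M \<boxtimes>\<^bsub>R\<^esub> N) x (pure_tensor R M N y z)"
    if "x \<in> carrier L" "y \<in> carrier M" "z \<in> carrier N" for x y z
    using LM_N.tensor_lift_pure[OF T.module_axioms b LM.pt_closed] gp that
    by (simp add: tensor_assoc_def g_def[abs_def])
qed

lemma tensor_assoc_inv:
  assumes "module R L" "module R M" "module R N"
  shows tensor_assoc_inv_hom: "tensor_assoc_inv R L M N \<in>
      module_hom R (L \<boxtimes>\<^bsub>R\<^esub> (M \<boxtimes>\<^bsub>R\<^esub> N)) (L \<boxtimes>\<^bsub>R\<^esub> M \<boxtimes>\<^bsub>R\<^esub> N)"
    and tensor_assoc_inv_pure: "\<And>x y z. x \<in> carrier L \<Longrightarrow> y \<in> carrier M \<Longrightarrow> z \<in> carrier N \<Longrightarrow>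
      tensor_assoc_inv R L M N (pure_tensor R L (M \<boxtimes>\<^bsub>R\<^esub> N) x (pure_tensor R M N y z)) =
      pure_tensor R (L \<boxtimes>\<^bsub>R\<^esub> M) N (pure_tensor R L M x y) z"
proof -
  interpret LM: tensor_pair R L M using assms by (intro tensor_pair.intro)
  interpret MN: tensor_pair R M N using assms by (intro tensor_pair.intro)
  interpret LM_N: tensor_pair R "L \<boxtimes>\<^bsub>R\<^esub> M" N
    using assms LM.module_tensor by (intro tensor_pair.intro)
  interpret L_MN: tensor_pair R L "M \<boxtimes>\<^bsub>R\<^esub> N"
    using assms MN.module_tensor by (intro tensor_pair.intro)
  interpret T: module R "L \<boxtimes>\<^bsub>R\<^esub> M \<boxtimes>\<^bsub>R\<^esub> N" by (rule LM_N.module_tensor)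
  define g where "g x y z = pure_tensor R (L \<boxtimes>\<^bsub>R\<^esub> M) N (pure_tensor R L M x y) z" for x y z
  have g: "g x \<in> bilinear_maps R M N (L \<boxtimes>\<^bsub>R\<^esub> M \<boxtimes>\<^bsub>R\<^esub> N)" if "x \<in> carrier L" for x
    unfolding g_def using that
    by (intro bilinear_mapsI)
      (simp_all add: bilinear_mapsD[OF LM_N.pt_bilinear] bilinear_mapsD[OF LM.pt_bilinear])
  have g_add: "g (x \<oplus>\<^bsub>L\<^esub> x') y z = g x y z \<oplus>\<^bsub>L \<boxtimes>\<^bsub>R\<^esub> M \<boxtimes>\<^bsub>R\<^esub> N\<^esub> g x' y z"
    if "x \<in> carrier L" "x' \<in> carrier L" "y \<in> carrier M" "z \<in> carrier N" for x x' y z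
    using that by (simp add: g_def bilinear_mapsD[OF LM_N.pt_bilinear] bilinear_mapsD[OF LM.pt_bilinear])
  have g_smult: "g (r \<odot>\<^bsub>L\<^esub> x) y z = r \<odot>\<^bsub>L \<boxtimes>\<^bsub>R\<^esub> M \<boxtimes>\<^bsub>R\<^esub> N\<^esub> g x y z"
    if "r \<in> carrier R" "x \<in> carrier L" "y \<in> carrier M" "z \<in> carrier N" for r x y z
    using that by (simp add: g_def bilinear_mapsD[OF LM_N.pt_bilinear] bilinear_mapsD[OF LM.pt_bilinear])
  note gh = MN.tensor_lift_hom[OF T.module_axioms g] and gp = MN.tensor_lift_pure[OF T.module_axioms g]
  note gD = module_homD[OF gh]
  let ?k = "\<lambda>x. tensor_lift R M N (L \<boxtimes>\<^bsub>R\<^esub> M \<boxtimes>\<^bsub>R\<^esub> N) (g x)"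
  have b: "?k \<in> bilinear_maps R L (M \<boxtimes>\<^bsub>R\<^esub> N) (L \<boxtimes>\<^bsub>R\<^esub> M \<boxtimes>\<^bsub>R\<^esub> N)"
  proof (rule bilinear_mapsI)
    fix x x' t assume t: "t \<in> carrier (M \<boxtimes>\<^bsub>R\<^esub> N)" and x: "x \<in> carrier L" "x' \<in> carrier L"
    have xx: "x \<oplus>\<^bsub>L\<^esub> x' \<in> carrier L" using x by simp
    show "?k (x \<oplus>\<^bsub>L\<^esub> x') t = ?k x t \<oplus>\<^bsub>L \<boxtimes>\<^bsub>R\<^esub> M \<boxtimes>\<^bsub>R\<^esub> N\<^esub> ?k x' t"
      using t
    proof (induction t rule: MN.tensor_induct)
      case (pure y z)
      then show ?case using x
        by (simp add: gp[OF xx] gp[OF x(1)] gp[OF x(2)] g_add)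
    next
      case (add s t)
      then show ?case by (simp add: gD[OF xx] gD[OF x(1)] gD[OF x(2)] T.M.a_ac)
    next
      case (smult r t)
      then show ?case by (simp add: gD[OF xx] gD[OF x(1)] gD[OF x(2)] T.smult_r_distr)
    qed
  next
    fix r x t assume r: "r \<in> carrier R" and t: "t \<in> carrier (M \<boxtimes>\<^bsub>R\<^esub> N)" and x: "x \<in> carrier L"
    have rx: "r \<odot>\<^bsub>L\<^esub> x \<in> carrier L" using r x by simp
    show "?k (r \<odot>\<^bsub>L\<^esub> x) t = r \<odot>\<^bsub>L \<boxtimes>\<^bsub>R\<^esub> M \<boxtimes>\<^bsub>R\<^esub> N\<^esub> ?k x t"
      using t
    proof (induction t rule: MN.tensor_induct)
      case (pure y z)
      then show ?case using r x
        by (simp add: gp[OF rx] gp[OF x] g_smult)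
    next
      case (add s t)
      then show ?case using r by (simp add: gD[OF rx] gD[OF x] T.smult_r_distr)
    next
      case (smult r' t)
      then show ?case using r
        by (simp add: gD[OF rx] gD[OF x] LM.M.m_comm flip: T.smult_assoc1)
    qed
  qed (simp_all add: gD)
  show "tensor_assoc_inv R L M N \<in> module_hom R (L \<boxtimes>\<^bsub>R\<^esub> (M \<boxtimes>\<^bsub>R\<^esub> N)) (L \<boxtimes>\<^bsub>R\<^esub> M \<boxtimes>\<^bsub>R\<^esub> N)"
    using L_MN.tensor_lift_hom[OF T.module_axioms b] by (simp add: tensor_assoc_inv_def g_def[abs_def])
  show "tensor_assoc_inv R L M N (pure_tensor R L (M \<boxtimes>\<^bsub>R\<^esub> N) x (pure_tensor R M N y z)) =
      pure_tensor R (L \<boxtimes>\<^bsub>R\<^esub> M) N (pure_tensor R L M x y) z"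
    if "x \<in> carrier L" "y \<in> carrier M" "z \<in> carrier N" for x y z
    using L_MN.tensor_lift_pure[OF T.module_axioms b _ MN.pt_closed] gp that
    by (simp add: tensor_assoc_inv_def g_def[abs_def])
qed


section \<open>Twist maps\<close>

locale unital_algebra = module R A + ring A
  for R (structure) and A (structure) +
  assumes smult_mult_left:
      "\<lbrakk>r \<in> carrier R; x \<in> carrier A; y \<in> carrier A\<rbrakk> \<Longrightarrow>
        (r \<odot>\<^bsub>A\<^esub> x) \<otimes>\<^bsub>A\<^esub> y = r \<odot>\<^bsub>A\<^esub> (x \<otimes>\<^bsub>A\<^esub> y)"
    and smult_mult_right:
      "\<lbrakk>r \<in> carrier R; x \<in> carrier A; y \<in> carrier A\<rbrakk> \<Longrightarrow>
        x \<otimes>\<^bsub>A\<^esub> (r \<odot>\<^bsub>A\<^esub> y) = r \<odot>\<^bsub>A\<^esub> (x \<otimes>\<^bsub>A\<^esub> y)"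

definition alg_mult ::
  "('k, 'r) ring_scheme \<Rightarrow> ('k, 'a, 'x) module_scheme \<Rightarrow> ('a \<times> 'a \<Rightarrow> 'k) set \<Rightarrow> 'a"
  where "alg_mult R A = tensor_lift R A A A (\<lambda>x y. x \<otimes>\<^bsub>A\<^esub> y)"

definition twist_maps where
  "twist_maps R A B = module_hom R (B \<boxtimes>\<^bsub>R\<^esub> A) (A \<boxtimes>\<^bsub>R\<^esub> B)"

text \<open>Morphisms between \<open>(B, A)\<close>-bimodules \<open>V\<close> and \<open>W\<close>, whose left \<open>B\<close>-actions are
  \<open>lV\<close>, \<open>lW\<close> and whose right \<open>A\<close>-actions are \<open>rV\<close>, \<open>rW\<close>, all written with the
  scalar as first argument.\<close>

definition bimodule_homs ::
  "('b, 'r) ring_scheme \<Rightarrow> ('a, 's) ring_scheme \<Rightarrow>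
   ('v, 'x) ring_scheme \<Rightarrow> ('b \<Rightarrow> 'v \<Rightarrow> 'v) \<Rightarrow> ('a \<Rightarrow> 'v \<Rightarrow> 'v) \<Rightarrow>
   ('w, 'y) ring_scheme \<Rightarrow> ('b \<Rightarrow> 'w \<Rightarrow> 'w) \<Rightarrow> ('a \<Rightarrow> 'w \<Rightarrow> 'w) \<Rightarrow> ('v \<Rightarrow> 'w) set"
  where "bimodule_homs B A V lV rV W lW rW = {h \<in> carrier V \<rightarrow> carrier W.
     (\<forall>x\<in>carrier V. \<forall>y\<in>carrier V. h (x \<oplus>\<^bsub>V\<^esub> y) = h x \<oplus>\<^bsub>W\<^esub> h y) \<and>
     (\<forall>b\<in>carrier B. \<forall>x\<in>carrier V. h (lV b x) = lW b (h x)) \<and>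
     (\<forall>a\<in>carrier A. \<forall>x\<in>carrier V. h (rV a x) = rW a (h x))}"

text \<open>The bimodules \<open>B \<boxtimes> A\<close> and \<open>A \<boxtimes> B\<close>: \<open>B\<close> acts by left multiplication on the factor \<open>B\<close>,
  and \<open>A\<close> by right multiplication on the factor \<open>A\<close>.\<close>

definition twist_bimodule_homs where
  "twist_bimodule_homs R A B = bimodule_homs B A
     (B \<boxtimes>\<^bsub>R\<^esub> A)
       (\<lambda>b'. tensor_map R B A B A (\<lambda>b. b' \<otimes>\<^bsub>B\<^esub> b) id)
       (\<lambda>a'. tensor_map R B A B A id (\<lambda>a. a \<otimes>\<^bsub>A\<^esub> a'))
     (A \<boxtimes>\<^bsub>R\<^esub> B)
       (\<lambda>b'. tensor_map R A B A B id (\<lambda>b. b' \<otimes>\<^bsub>B\<^esub> b))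
       (\<lambda>a'. tensor_map R A B A B (\<lambda>a. a \<otimes>\<^bsub>A\<^esub> a') id)"

text \<open>The two sides of the twisting equation, as maps from \<open>(B \<boxtimes> A) \<boxtimes> (B \<boxtimes> A)\<close> to \<open>A \<boxtimes> B\<close>.
  Bracketing is explicit, so the reassociations that are usually suppressed appear as factors;
  \<open>\<psi>\<close> and the multiplications are applied in the order of the unbracketed formulas
  \<open>(id\<^sub>A \<otimes> m\<^sub>B)(\<psi> \<otimes> id\<^sub>B)(id\<^sub>B \<otimes> m\<^sub>A \<otimes> id\<^sub>B)(id\<^sub>B \<otimes> id\<^sub>A \<otimes> \<psi>)\<close> and
  \<open>(m\<^sub>A \<otimes> id\<^sub>B)(id\<^sub>A \<otimes> \<psi>)(id\<^sub>A \<otimes> m\<^sub>B \<otimes> id\<^sub>A)(\<psi> \<otimes> id\<^sub>B \<otimes> id\<^sub>A)\<close>.\<close>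

definition twisting_lhs where
  "twisting_lhs R A B \<psi> =
     tensor_map R A (B \<boxtimes>\<^bsub>R\<^esub> B) A B id (alg_mult R B)
   \<circ> tensor_assoc R A B B
   \<circ> tensor_map R (B \<boxtimes>\<^bsub>R\<^esub> A) B (A \<boxtimes>\<^bsub>R\<^esub> B) B \<psi> id
   \<circ> tensor_map R (B \<boxtimes>\<^bsub>R\<^esub> (A \<boxtimes>\<^bsub>R\<^esub> A)) B (B \<boxtimes>\<^bsub>R\<^esub> A) B
       (tensor_map R B (A \<boxtimes>\<^bsub>R\<^esub> A) B A id (alg_mult R A)) id
   \<circ> tensor_map R (B \<boxtimes>\<^bsub>R\<^esub> A \<boxtimes>\<^bsub>R\<^esub> A) B (B \<boxtimes>\<^bsub>R\<^esub> (A \<boxtimes>\<^bsub>R\<^esub> A)) B (tensor_assoc R B A A) id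
   \<circ> tensor_assoc_inv R (B \<boxtimes>\<^bsub>R\<^esub> A) A B
   \<circ> tensor_map R (B \<boxtimes>\<^bsub>R\<^esub> A) (B \<boxtimes>\<^bsub>R\<^esub> A) (B \<boxtimes>\<^bsub>R\<^esub> A) (A \<boxtimes>\<^bsub>R\<^esub> B) id \<psi>"

definition twisting_rhs where
  "twisting_rhs R A B \<psi> =
     tensor_map R (A \<boxtimes>\<^bsub>R\<^esub> A) B A B (alg_mult R A) id
   \<circ> tensor_assoc_inv R A A B
   \<circ> tensor_map R A (B \<boxtimes>\<^bsub>R\<^esub> A) A (A \<boxtimes>\<^bsub>R\<^esub> B) id \<psi>
   \<circ> tensor_map R A (B \<boxtimes>\<^bsub>R\<^esub> B \<boxtimes>\<^bsub>R\<^esub> A) A (B \<boxtimes>\<^bsub>R\<^esub> A) id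
       (tensor_map R (B \<boxtimes>\<^bsub>R\<^esub> B) A B A (alg_mult R B) id)
   \<circ> tensor_map R A (B \<boxtimes>\<^bsub>R\<^esub> (B \<boxtimes>\<^bsub>R\<^esub> A)) A (B \<boxtimes>\<^bsub>R\<^esub> B \<boxtimes>\<^bsub>R\<^esub> A) id (tensor_assoc_inv R B B A)
   \<circ> tensor_assoc R A B (B \<boxtimes>\<^bsub>R\<^esub> A)
   \<circ> tensor_map R (B \<boxtimes>\<^bsub>R\<^esub> A) (B \<boxtimes>\<^bsub>R\<^esub> A) (A \<boxtimes>\<^bsub>R\<^esub> B) (B \<boxtimes>\<^bsub>R\<^esub> A) \<psi> id"

text \<open>\<open>(m\<^sub>A \<otimes> m\<^sub>B)(id\<^sub>A \<otimes> \<psi> \<otimes> id\<^sub>B)\<close> as a map from \<open>(A \<boxtimes> B) \<boxtimes> (A \<boxtimes> B)\<close> to \<open>A \<boxtimes> B\<close>, again with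
  explicit reassociations.\<close>

definition twisted_mult where
  "twisted_mult R A B \<psi> =
     tensor_map R (A \<boxtimes>\<^bsub>R\<^esub> A) (B \<boxtimes>\<^bsub>R\<^esub> B) A B (alg_mult R A) (alg_mult R B)
   \<circ> tensor_assoc_inv R A A (B \<boxtimes>\<^bsub>R\<^esub> B)
   \<circ> tensor_map R A (A \<boxtimes>\<^bsub>R\<^esub> B \<boxtimes>\<^bsub>R\<^esub> B) A (A \<boxtimes>\<^bsub>R\<^esub> (B \<boxtimes>\<^bsub>R\<^esub> B)) id (tensor_assoc R A B B)
   \<circ> tensor_map R A (B \<boxtimes>\<^bsub>R\<^esub> A \<boxtimes>\<^bsub>R\<^esub> B) A (A \<boxtimes>\<^bsub>R\<^esub> B \<boxtimes>\<^bsub>R\<^esub> B) id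
       (tensor_map R (B \<boxtimes>\<^bsub>R\<^esub> A) B (A \<boxtimes>\<^bsub>R\<^esub> B) B \<psi> id)
   \<circ> tensor_map R A (B \<boxtimes>\<^bsub>R\<^esub> (A \<boxtimes>\<^bsub>R\<^esub> B)) A (B \<boxtimes>\<^bsub>R\<^esub> A \<boxtimes>\<^bsub>R\<^esub> B) id (tensor_assoc_inv R B A B)
   \<circ> tensor_assoc R A B (A \<boxtimes>\<^bsub>R\<^esub> B)"

definition associative_product ::
  "('k, 'r) ring_scheme \<Rightarrow> ('k, 'v, 'x) module_scheme \<Rightarrow> (('v \<times> 'v \<Rightarrow> 'k) set \<Rightarrow> 'v) \<Rightarrow> bool"
  where "associative_product R V m \<longleftrightarrow>
     m \<in> module_hom R (V \<boxtimes>\<^bsub>R\<^esub> V) V \<and>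
     (\<forall>x\<in>carrier V. \<forall>y\<in>carrier V. \<forall>z\<in>carrier V.
        m (pure_tensor R V V (m (pure_tensor R V V x y)) z) =
        m (pure_tensor R V V x (m (pure_tensor R V V y z))))"

end

theory Submission
  imports Defs
begin

text \<open>The bimodule \<open>B \<boxtimes> A\<close> is generated by \<open>1 \<otimes> 1\<close>, so a bimodule morphism \<open>\<psi>\<close> is determined by
  the single element \<open>w = \<psi>(1 \<otimes> 1)\<close> of \<open>A \<boxtimes> B\<close>. Let \<open>\<star>\<close> be the ordinary product
  \<open>(a \<otimes> b) \<star> (a' \<otimes> b') = aa' \<otimes> bb'\<close>. The two actions on \<open>A \<boxtimes> B\<close> are \<open>\<star>\<close>-multiplication by
  \<open>1 \<otimes> b\<close> on the left and by \<open>a \<otimes> 1\<close> on the right, whence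
  \<open>\<psi>(b \<otimes> a) = (1 \<otimes> b) \<star> w \<star> (a \<otimes> 1)\<close> (\<open>twist_pure\<close>). Everything now takes place in the
  associative algebra \<open>(A \<boxtimes> B, \<star>)\<close>, in which \<open>a \<otimes> b = (a \<otimes> 1) \<star> (1 \<otimes> b) = (1 \<otimes> b) \<star> (a \<otimes> 1)\<close>.

  In the left side of the twisting equation, the outer \<open>\<psi>\<close> is evaluated at \<open>b \<otimes> a\<alpha>\<close> for the terms
  \<open>\<alpha> \<otimes> \<beta>\<close> of \<open>\<psi>(t)\<close>, and the result is multiplied by \<open>\<beta>\<close>. By the formula for \<open>\<psi>\<close> this is
  \<open>\<psi>(b \<otimes> a) \<star> (\<alpha> \<otimes> \<beta>)\<close>, so the left side sends \<open>s \<otimes> t\<close> to \<open>\<psi>(s) \<star> \<psi>(t)\<close>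
  (\<open>twisting_lhs_eq\<close>). The right side gives the same value for the symmetric reason
  (\<open>twisting_rhs_eq\<close>).

  Similarly, the twisted product of \<open>a \<otimes> b\<close> and \<open>a' \<otimes> b'\<close> is
  \<open>(a \<otimes> 1) \<star> (1 \<otimes> b) \<star> w \<star> (a' \<otimes> 1) \<star> (1 \<otimes> b')\<close>, so \<open>m\<^sub>\<psi>(x \<otimes> y) = x \<star> w \<star> y\<close>
  (\<open>twisted_mult_eq\<close>), and both bracketings of a triple product are \<open>x \<star> w \<star> y \<star> w \<star> z\<close>.\<close>

section \<open>Homomorphisms out of tensor products\<close>

lemma module_tensor: "module R M \<Longrightarrow> module R N \<Longrightarrow> module R (M \<boxtimes>\<^bsub>R\<^esub> N)"
  by (intro tensor_pair.module_tensor tensor_pair.intro)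

lemma pure_tensor_closed:
  "module R M \<Longrightarrow> module R N \<Longrightarrow> x \<in> carrier M \<Longrightarrow> y \<in> carrier N \<Longrightarrow>
    pure_tensor R M N x y \<in> carrier (M \<boxtimes>\<^bsub>R\<^esub> N)"
  by (intro tensor_pair.pt_closed tensor_pair.intro)

lemma module_hom_id: "id \<in> module_hom R M M" "(\<lambda>x. x) \<in> module_hom R M M"
  by (simp_all add: module_hom_def)

lemma module_hom_comp:
  assumes g: "g \<in> module_hom R N P" and f: "f \<in> module_hom R M N"
  shows "g \<circ> f \<in> module_hom R M P"
  by (auto simp: module_hom_def[of R M P] module_homD[OF g] module_homD[OF f])

lemma pure_tensor_hom:
  assumes "module R M" "module R N"
  shows pure_tensor_hom_right: "x \<in> carrier M \<Longrightarrow> pure_tensor R M N x \<in> module_hom R N (M \<boxtimes>\<^bsub>R\<^esub> N)"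
    and pure_tensor_hom_left:
      "y \<in> carrier N \<Longrightarrow> (\<lambda>x. pure_tensor R M N x y) \<in> module_hom R M (M \<boxtimes>\<^bsub>R\<^esub> N)"
  using tensor_pair.pt_bilinear[OF tensor_pair.intro[OF assms]] by (auto simp: bilinear_maps_def)

lemma tensor_hom_eqI:
  assumes "module R M" "module R N"
    and f: "f \<in> module_hom R (M \<boxtimes>\<^bsub>R\<^esub> N) P" and g: "g \<in> module_hom R (M \<boxtimes>\<^bsub>R\<^esub> N) P"
    and eq: "\<And>x y. x \<in> carrier M \<Longrightarrow> y \<in> carrier N \<Longrightarrow>
      f (pure_tensor R M N x y) = g (pure_tensor R M N x y)"
    and t: "t \<in> carrier (M \<boxtimes>\<^bsub>R\<^esub> N)"
  shows "f t = g t"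
proof -
  interpret tensor_pair R M N using assms by (intro tensor_pair.intro)
  show ?thesis
    using t by (induction t rule: tensor_induct) (simp_all add: eq module_homD[OF f] module_homD[OF g])
qed

text \<open>The domain of each map to be compared is a tensor product of two tensor products, where not
  every element of the form \<open>v \<otimes> w\<close> has \<open>v\<close> and \<open>w\<close> pure. Fixing first a pure \<open>v\<close> and then an
  arbitrary \<open>w\<close> leaves a linear map in the other variable, so agreement spreads one factor at a
  time.\<close>

lemma tensor_hom_eqI4:
  assumes mods: "module R K" "module R L" "module R M" "module R N"
    and f: "f \<in> module_hom R ((K \<boxtimes>\<^bsub>R\<^esub> L) \<boxtimes>\<^bsub>R\<^esub> (M \<boxtimes>\<^bsub>R\<^esub> N)) P"
    and g: "g \<in> module_hom R ((K \<boxtimes>\<^bsub>R\<^esub> L) \<boxtimes>\<^bsub>R\<^esub> (M \<boxtimes>\<^bsub>R\<^esub> N)) P"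
    and eq: "\<And>x y z u. x \<in> carrier K \<Longrightarrow> y \<in> carrier L \<Longrightarrow> z \<in> carrier M \<Longrightarrow> u \<in> carrier N \<Longrightarrow>
      f (pure_tensor R (K \<boxtimes>\<^bsub>R\<^esub> L) (M \<boxtimes>\<^bsub>R\<^esub> N) (pure_tensor R K L x y) (pure_tensor R M N z u)) =
      g (pure_tensor R (K \<boxtimes>\<^bsub>R\<^esub> L) (M \<boxtimes>\<^bsub>R\<^esub> N) (pure_tensor R K L x y) (pure_tensor R M N z u))"
    and t: "t \<in> carrier ((K \<boxtimes>\<^bsub>R\<^esub> L) \<boxtimes>\<^bsub>R\<^esub> (M \<boxtimes>\<^bsub>R\<^esub> N))"
  shows "f t = g t"
proof (rule tensor_hom_eqI[OF _ _ f g _ t])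
  let ?p = "pure_tensor R (K \<boxtimes>\<^bsub>R\<^esub> L) (M \<boxtimes>\<^bsub>R\<^esub> N)"
  note T = module_tensor[OF mods(1,2)] module_tensor[OF mods(3,4)]
  show "module R (K \<boxtimes>\<^bsub>R\<^esub> L)" "module R (M \<boxtimes>\<^bsub>R\<^esub> N)" by (fact T)+
  fix v w assume v: "v \<in> carrier (K \<boxtimes>\<^bsub>R\<^esub> L)" and w: "w \<in> carrier (M \<boxtimes>\<^bsub>R\<^esub> N)"
  have pure_left: "(f \<circ> ?p (pure_tensor R K L x y)) w = (g \<circ> ?p (pure_tensor R K L x y)) w"
    if xy: "x \<in> carrier K" "y \<in> carrier L" for x y
    by (rule tensor_hom_eqI[OF mods(3,4) _ _ _ w],
        ((rule module_hom_comp[OF f] module_hom_comp[OF g] pure_tensor_hom_right T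
          pure_tensor_closed mods xy)+)[2])
      (simp add: eq xy)
  have "(f \<circ> (\<lambda>v. ?p v w)) v = (g \<circ> (\<lambda>v. ?p v w)) v"
    by (rule tensor_hom_eqI[OF mods(1,2) _ _ _ v],
        ((rule module_hom_comp[OF f] module_hom_comp[OF g] pure_tensor_hom_left T w)+)[2])
      (use pure_left in simp)
  then show "f (?p v w) = g (?p v w)" by simp
qed


section \<open>The ordinary tensor product algebra\<close>

definition tensor_flip where
  "tensor_flip R A B = tensor_lift R B A (A \<boxtimes>\<^bsub>R\<^esub> B) (\<lambda>b a. pure_tensor R A B a b)"

lemma tensor_flip:
  assumes "module R A" "module R B"
  shows tensor_flip_twist: "tensor_flip R A B \<in> twist_maps R A B"
    and tensor_flip_pure: "\<And>a b. a \<in> carrier A \<Longrightarrow> b \<in> carrier B \<Longrightarrow>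
      tensor_flip R A B (pure_tensor R B A b a) = pure_tensor R A B a b"
proof -
  interpret BA: tensor_pair R B A using assms by (intro tensor_pair.intro)
  interpret AB: tensor_pair R A B using assms by (intro tensor_pair.intro)
  have b: "(\<lambda>b a. pure_tensor R A B a b) \<in> bilinear_maps R B A (A \<boxtimes>\<^bsub>R\<^esub> B)"
    using AB.pt_bilinear by (auto simp: bilinear_maps_def)
  show "tensor_flip R A B \<in> twist_maps R A B"
    and "\<And>a b. a \<in> carrier A \<Longrightarrow> b \<in> carrier B \<Longrightarrow>
      tensor_flip R A B (pure_tensor R B A b a) = pure_tensor R A B a b"
    unfolding tensor_flip_def twist_maps_def
    using BA.tensor_lift_hom[OF AB.module_tensor b] BA.tensor_lift_pure[OF AB.module_tensor b] by auto
qed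

context unital_algebra begin

lemma mult_hom:
  "a \<in> carrier A \<Longrightarrow> (\<lambda>x. a \<otimes>\<^bsub>A\<^esub> x) \<in> module_hom R A A"
  "a \<in> carrier A \<Longrightarrow> (\<lambda>x. x \<otimes>\<^bsub>A\<^esub> a) \<in> module_hom R A A"
  by (auto simp: module_hom_def r_distr l_distr smult_mult_left smult_mult_right)

lemma alg_mult:
  shows alg_mult_hom: "alg_mult R A \<in> module_hom R (A \<boxtimes> A) A"
    and alg_mult_pure: "\<And>x y. x \<in> carrier A \<Longrightarrow> y \<in> carrier A \<Longrightarrow>
      alg_mult R A (pure_tensor R A A x y) = x \<otimes>\<^bsub>A\<^esub> y"
proof -
  interpret AA: tensor_pair R A A by (intro tensor_pair.intro module_axioms)
  have b: "(\<lambda>x y. x \<otimes>\<^bsub>A\<^esub> y) \<in> bilinear_maps R A A A"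
    by (auto simp: bilinear_maps_def mult_hom)
  show "alg_mult R A \<in> module_hom R (A \<boxtimes> A) A"
    and "\<And>x y. x \<in> carrier A \<Longrightarrow> y \<in> carrier A \<Longrightarrow>
      alg_mult R A (pure_tensor R A A x y) = x \<otimes>\<^bsub>A\<^esub> y"
    unfolding alg_mult_def
    using AA.tensor_lift_hom[OF module_axioms b] AA.tensor_lift_pure[OF module_axioms b] by auto
qed

end

locale algebra_pair = A: unital_algebra R A + B: unital_algebra R B
  for R (structure) and A (structure) and B (structure)
begin

abbreviation pure (infix \<open>\<otimes>\<^sub>p\<close> 75) where "a \<otimes>\<^sub>p b \<equiv> pure_tensor R A B a b"

lemmas modules = A.module_axioms B.module_axioms
lemmas hom_intros = modules module_tensor module_hom_id tensor_map_hom tensor_assoc_hom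
  tensor_assoc_inv_hom A.alg_mult_hom B.alg_mult_hom A.mult_hom B.mult_hom
  pure_tensor_hom_left pure_tensor_hom_right module_hom_comp
lemmas pure_simps = hom_intros pure_tensor_closed tensor_map_pure tensor_assoc_pure
  tensor_assoc_inv_pure A.alg_mult_pure B.alg_mult_pure

lemma twisted_mult_hom:
  assumes "\<psi> \<in> twist_maps R A B"
  shows "twisted_mult R A B \<psi> \<in> module_hom R ((A \<boxtimes> B) \<boxtimes> (A \<boxtimes> B)) (A \<boxtimes> B)"
  unfolding twisted_mult_def by (rule hom_intros assms[unfolded twist_maps_def])+

text \<open>On a pure argument the map reduces to the linear map \<open>t \<mapsto> a t b'\<close>, reassembled from the outer
  multiplications, at \<open>t = \<psi>(b \<otimes> a')\<close>; since that element need not be pure, this map is identified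
  by testing on pure tensors. The twist is arbitrary here because the lemma serves twice: for the
  flip, to compute the ordinary product, and for the \<open>\<psi>\<close> of interest.\<close>

lemma twisted_mult_pure:
  assumes \<psi>: "\<psi> \<in> twist_maps R A B"
    and c: "a \<in> carrier A" "b \<in> carrier B" "a' \<in> carrier A" "b' \<in> carrier B"
  shows "twisted_mult R A B \<psi> (pure_tensor R (A \<boxtimes> B) (A \<boxtimes> B) (a \<otimes>\<^sub>p b) (a' \<otimes>\<^sub>p b')) =
    tensor_map R A B A B (\<lambda>x. a \<otimes>\<^bsub>A\<^esub> x) (\<lambda>y. y \<otimes>\<^bsub>B\<^esub> b') (\<psi> (pure_tensor R B A b a'))"
proof -
  note \<psi>h = \<psi>[unfolded twist_maps_def]
  have u: "\<psi> (pure_tensor R B A b a') \<in> carrier (A \<boxtimes> B)"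
    using c by (intro module_hom_closed[OF \<psi>h] pure_tensor_closed modules)
  have "(tensor_map R (A \<boxtimes> A) (B \<boxtimes> B) A B (alg_mult R A) (alg_mult R B) \<circ>
      tensor_assoc_inv R A A (B \<boxtimes> B) \<circ>
      pure_tensor R A (A \<boxtimes> (B \<boxtimes> B)) a \<circ> tensor_assoc R A B B \<circ>
      (\<lambda>t. pure_tensor R (A \<boxtimes> B) B t b')) (\<psi> (pure_tensor R B A b a')) =
    tensor_map R A B A B (\<lambda>x. a \<otimes>\<^bsub>A\<^esub> x) (\<lambda>y. y \<otimes>\<^bsub>B\<^esub> b') (\<psi> (pure_tensor R B A b a'))"
  proof (rule tensor_hom_eqI[where P = "A \<boxtimes> B", OF modules _ _ _ u], goal_cases)
    case 1 show ?case by (rule hom_intros c)+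
  next
    case 2 show ?case by (rule hom_intros c)+
  next
    case (3 x y) then show ?case using c by (simp add: pure_simps)
  qed
  then show ?thesis
    using c u \<psi>h module_hom_closed[OF tensor_assoc_hom]
    by (simp add: twisted_mult_def pure_simps)
qed

text \<open>The ordinary product is the twisted product of the flip. With this choice it
  inherits bilinearity from \<open>twisted_mult_hom\<close>, and its values on pure tensors are a case of
  \<open>twisted_mult_pure\<close>.\<close>

definition tensor_mult (infixl \<open>\<star>\<close> 70) where
  "x \<star> y = twisted_mult R A B (tensor_flip R A B) (pure_tensor R (A \<boxtimes> B) (A \<boxtimes> B) x y)"

lemma star_pure:
  "\<lbrakk>a \<in> carrier A; b \<in> carrier B; a' \<in> carrier A; b' \<in> carrier B\<rbrakk> \<Longrightarrow>
    (a \<otimes>\<^sub>p b) \<star> (a' \<otimes>\<^sub>p b') = (a \<otimes>\<^bsub>A\<^esub> a') \<otimes>\<^sub>p (b \<otimes>\<^bsub>B\<^esub> b')"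
  by (simp add: tensor_mult_def twisted_mult_pure tensor_flip_twist tensor_flip_pure pure_simps)

lemma star_hom:
  shows star_hom_right: "x \<in> carrier (A \<boxtimes> B) \<Longrightarrow> (\<lambda>y. x \<star> y) \<in> module_hom R (A \<boxtimes> B) (A \<boxtimes> B)"
    and star_hom_left: "y \<in> carrier (A \<boxtimes> B) \<Longrightarrow> (\<lambda>x. x \<star> y) \<in> module_hom R (A \<boxtimes> B) (A \<boxtimes> B)"
proof -
  note m = twisted_mult_hom[OF tensor_flip_twist[OF modules]]
  show "(\<lambda>y. x \<star> y) \<in> module_hom R (A \<boxtimes> B) (A \<boxtimes> B)" if "x \<in> carrier (A \<boxtimes> B)"
    using module_hom_comp[OF m pure_tensor_hom_right] that
    by (simp add: tensor_mult_def comp_def modules module_tensor)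
  show "(\<lambda>x. x \<star> y) \<in> module_hom R (A \<boxtimes> B) (A \<boxtimes> B)" if "y \<in> carrier (A \<boxtimes> B)"
    using module_hom_comp[OF m pure_tensor_hom_left] that
    by (simp add: tensor_mult_def comp_def modules module_tensor)
qed

lemma star_closed: "\<lbrakk>x \<in> carrier (A \<boxtimes> B); y \<in> carrier (A \<boxtimes> B)\<rbrakk> \<Longrightarrow> x \<star> y \<in> carrier (A \<boxtimes> B)"
  by (rule module_hom_closed[OF star_hom_right])

lemma star_assoc:
  assumes x: "x \<in> carrier (A \<boxtimes> B)" and y: "y \<in> carrier (A \<boxtimes> B)" and z: "z \<in> carrier (A \<boxtimes> B)"
  shows "(x \<star> y) \<star> z = x \<star> (y \<star> z)"
proof -
  interpret T: tensor_pair R A B by (intro tensor_pair.intro modules)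
  interpret TM: module R "A \<boxtimes> B" by (rule T.module_tensor)
  note L = module_homD[OF star_hom_left] and R = module_homD[OF star_hom_right]
  show ?thesis using x
  proof (induction x rule: T.tensor_induct)
    case (pure a b)
    note ab = pure
    show ?case using y
    proof (induction y rule: T.tensor_induct)
      case (pure a' b')
      show ?case using z
        by (induction z rule: T.tensor_induct)
          (use ab pure in \<open>simp_all add: star_pure A.m_assoc B.m_assoc T.pt_closed star_closed R\<close>)
    qed (use ab z in \<open>simp_all add: T.pt_closed star_closed R L\<close>)
  qed (use y z in \<open>simp_all add: star_closed L\<close>)
qed

abbreviation inA (\<open>\<iota>\<^sub>A\<close>) where "\<iota>\<^sub>A a \<equiv> a \<otimes>\<^sub>p \<one>\<^bsub>B\<^esub>"
abbreviation inB (\<open>\<iota>\<^sub>B\<close>) where "\<iota>\<^sub>B b \<equiv> \<one>\<^bsub>A\<^esub> \<otimes>\<^sub>p b"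

lemma pure_closed: "a \<in> carrier A \<Longrightarrow> b \<in> carrier B \<Longrightarrow> a \<otimes>\<^sub>p b \<in> carrier (A \<boxtimes> B)"
  by (intro pure_tensor_closed modules)

text \<open>The operations entering twisted products and the bimodule structures become multiplications by
  elements of the form \<open>a \<otimes> 1\<close> or \<open>1 \<otimes> b\<close>.\<close>

lemma tensor_map_eq_star:
  assumes c: "a \<in> carrier A" "b \<in> carrier B" and t: "t \<in> carrier (A \<boxtimes> B)"
  shows "tensor_map R A B A B (\<lambda>x. a \<otimes>\<^bsub>A\<^esub> x) (\<lambda>y. y \<otimes>\<^bsub>B\<^esub> b) t = \<iota>\<^sub>A a \<star> t \<star> \<iota>\<^sub>B b"
    and "tensor_map R A B A B id (\<lambda>y. b \<otimes>\<^bsub>B\<^esub> y) t = \<iota>\<^sub>B b \<star> t"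
    and "tensor_map R A B A B (\<lambda>x. x \<otimes>\<^bsub>A\<^esub> a) id t = t \<star> \<iota>\<^sub>A a"
proof -
  have "tensor_map R A B A B (\<lambda>x. a \<otimes>\<^bsub>A\<^esub> x) (\<lambda>y. y \<otimes>\<^bsub>B\<^esub> b) t = ((\<lambda>t. t \<star> \<iota>\<^sub>B b) \<circ> (\<lambda>t. \<iota>\<^sub>A a \<star> t)) t"
    by (rule tensor_hom_eqI[OF modules _ _ _ t],
        ((rule hom_intros star_hom pure_closed c A.one_closed B.one_closed)+)[2])
      (use c in \<open>simp_all add: pure_simps star_pure\<close>)
  then show "tensor_map R A B A B (\<lambda>x. a \<otimes>\<^bsub>A\<^esub> x) (\<lambda>y. y \<otimes>\<^bsub>B\<^esub> b) t = \<iota>\<^sub>A a \<star> t \<star> \<iota>\<^sub>B b" by simp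
  show "tensor_map R A B A B id (\<lambda>y. b \<otimes>\<^bsub>B\<^esub> y) t = \<iota>\<^sub>B b \<star> t"
    by (rule tensor_hom_eqI[OF modules _ _ _ t],
        ((rule hom_intros star_hom pure_closed c A.one_closed B.one_closed)+)[2])
      (use c in \<open>simp_all add: pure_simps star_pure\<close>)
  show "tensor_map R A B A B (\<lambda>x. x \<otimes>\<^bsub>A\<^esub> a) id t = t \<star> \<iota>\<^sub>A a"
    by (rule tensor_hom_eqI[OF modules _ _ _ t],
        ((rule hom_intros star_hom pure_closed c A.one_closed B.one_closed)+)[2])
      (use c in \<open>simp_all add: pure_simps star_pure\<close>)
qed

text \<open>The last steps of the left side of the twisting equation, in terms of \<open>\<star>\<close>;
  \<open>mult_left_eq_star\<close> is the counterpart for the right side.\<close>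

lemma mult_right_eq_star:
  assumes c: "b \<in> carrier B" and t: "t \<in> carrier (A \<boxtimes> B)"
  shows "tensor_map R A (B \<boxtimes> B) A B id (alg_mult R B)
      (tensor_assoc R A B B (pure_tensor R (A \<boxtimes> B) B t b)) = t \<star> \<iota>\<^sub>B b"
proof -
  have "(tensor_map R A (B \<boxtimes> B) A B id (alg_mult R B) \<circ> tensor_assoc R A B B \<circ>
      (\<lambda>t. pure_tensor R (A \<boxtimes> B) B t b)) t = t \<star> \<iota>\<^sub>B b"
    by (rule tensor_hom_eqI[OF modules _ _ _ t],
        ((rule hom_intros star_hom pure_closed c A.one_closed B.one_closed)+)[2])
      (use c in \<open>simp_all add: pure_simps star_pure\<close>)
  then show ?thesis by simp
qed

lemma mult_left_eq_star:
  assumes c: "a \<in> carrier A" and t: "t \<in> carrier (A \<boxtimes> B)"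
  shows "tensor_map R (A \<boxtimes> A) B A B (alg_mult R A) id
      (tensor_assoc_inv R A A B (pure_tensor R A (A \<boxtimes> B) a t)) = \<iota>\<^sub>A a \<star> t"
proof -
  have "(tensor_map R (A \<boxtimes> A) B A B (alg_mult R A) id \<circ> tensor_assoc_inv R A A B \<circ>
      pure_tensor R A (A \<boxtimes> B) a) t = \<iota>\<^sub>A a \<star> t"
    by (rule tensor_hom_eqI[OF modules _ _ _ t],
        ((rule hom_intros star_hom pure_closed c A.one_closed B.one_closed)+)[2])
      (use c in \<open>simp_all add: pure_simps star_pure\<close>)
  then show ?thesis by simp
qed

end


section \<open>Twist maps that are bimodule morphisms\<close>

locale bimodule_twist = algebra_pair +
  fixes \<psi>
  assumes twist: "\<psi> \<in> twist_maps R A B" and bimodule: "\<psi> \<in> twist_bimodule_homs R A B"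
begin

lemma twist_hom: "\<psi> \<in> module_hom R (B \<boxtimes> A) (A \<boxtimes> B)"
  using twist by (simp add: twist_maps_def)

lemma twist_closed: "s \<in> carrier (B \<boxtimes> A) \<Longrightarrow> \<psi> s \<in> carrier (A \<boxtimes> B)"
  by (rule module_hom_closed[OF twist_hom])

definition twist_one (\<open>w\<close>) where
  "w = \<psi> (pure_tensor R B A \<one>\<^bsub>B\<^esub> \<one>\<^bsub>A\<^esub>)"

lemma twist_one_closed: "w \<in> carrier (A \<boxtimes> B)"
  unfolding twist_one_def by (intro twist_closed pure_tensor_closed modules A.one_closed B.one_closed)

lemma BA_closed: "b \<in> carrier B \<Longrightarrow> a \<in> carrier A \<Longrightarrow> pure_tensor R B A b a \<in> carrier (B \<boxtimes> A)"
  by (intro pure_tensor_closed modules)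

lemma twist_pure:
  assumes c: "b \<in> carrier B" "a \<in> carrier A"
  shows "\<psi> (pure_tensor R B A b a) = \<iota>\<^sub>B b \<star> w \<star> \<iota>\<^sub>A a"
proof -
  have l: "\<psi> (tensor_map R B A B A (\<lambda>y. b \<otimes>\<^bsub>B\<^esub> y) id s) = \<iota>\<^sub>B b \<star> \<psi> s"
    and r: "\<psi> (tensor_map R B A B A id (\<lambda>x. x \<otimes>\<^bsub>A\<^esub> a) s) = \<psi> s \<star> \<iota>\<^sub>A a"
    if "s \<in> carrier (B \<boxtimes> A)" for s
    using bimodule c that
    by (auto simp: twist_bimodule_homs_def bimodule_homs_def tensor_map_eq_star twist_closed)
  have "\<psi> (pure_tensor R B A b \<one>\<^bsub>A\<^esub>) = \<iota>\<^sub>B b \<star> w"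
    using l[OF BA_closed[OF B.one_closed A.one_closed]] c by (simp add: twist_one_def pure_simps)
  then show ?thesis
    using r[OF BA_closed[OF c(1) A.one_closed]] c by (simp add: pure_simps)
qed

lemmas star_simps = star_closed star_assoc pure_closed twist_one_closed

text \<open>The argument \<open>a'\<close> can be moved out of \<open>\<psi>\<close> on the right because \<open>(aa') \<otimes> 1 = (a \<otimes> 1) \<star> (a' \<otimes> 1)\<close>
  stands at the right end of the formula for \<open>\<psi>\<close>. This lemma and its mirror image
  \<open>twist_mult_left\<close> evaluate the outer \<open>\<psi>\<close> in the two sides of the twisting equation.\<close>

lemma twist_mult_right:
  assumes c: "b \<in> carrier B" "a \<in> carrier A" "a' \<in> carrier A" "b' \<in> carrier B"
  shows "\<psi> (pure_tensor R B A b (a \<otimes>\<^bsub>A\<^esub> a')) \<star> \<iota>\<^sub>B b' = \<psi> (pure_tensor R B A b a) \<star> (a' \<otimes>\<^sub>p b')"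
  using c by (simp add: twist_pure star_simps star_pure)

lemma twist_mult_left:
  assumes c: "a \<in> carrier A" "b \<in> carrier B" "b' \<in> carrier B" "a' \<in> carrier A"
  shows "\<iota>\<^sub>A a \<star> \<psi> (pure_tensor R B A (b \<otimes>\<^bsub>B\<^esub> b') a') = (a \<otimes>\<^sub>p b) \<star> \<psi> (pure_tensor R B A b' a')"
  using c by (simp add: twist_pure star_simps star_pure flip: star_assoc)

text \<open>The linear map \<open>x \<otimes> y \<mapsto> f x \<star> g y\<close>. Written as a composite it can be compared with the two
  sides of the twisting equation and with the twisted product by \<open>tensor_hom_eqI4\<close>.\<close>

lemma star_tensor_hom:
  assumes "f \<in> module_hom R M (A \<boxtimes> B)" "g \<in> module_hom R N (A \<boxtimes> B)" "module R M" "module R N"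
  shows "twisted_mult R A B (tensor_flip R A B) \<circ> tensor_map R M N (A \<boxtimes> B) (A \<boxtimes> B) f g
    \<in> module_hom R (M \<boxtimes> N) (A \<boxtimes> B)"
  by (rule module_hom_comp twisted_mult_hom tensor_flip_twist tensor_map_hom module_tensor
      modules assms)+

lemma star_tensor_pure:
  assumes "f \<in> module_hom R M (A \<boxtimes> B)" "g \<in> module_hom R N (A \<boxtimes> B)" "module R M" "module R N"
    and "x \<in> carrier M" "y \<in> carrier N"
  shows "(twisted_mult R A B (tensor_flip R A B) \<circ> tensor_map R M N (A \<boxtimes> B) (A \<boxtimes> B) f g)
      (pure_tensor R M N x y) = f x \<star> g y"
  using assms by (simp add: tensor_mult_def tensor_map_pure module_tensor modules)

text \<open>The innermost factor only replaces \<open>t\<close> by \<open>\<psi>(t)\<close>, which need not be pure. The remaining composite is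
  therefore compared with \<open>s \<otimes> u \<mapsto> \<psi>(s) \<star> u\<close> as a linear map on all of
  \<open>(B \<boxtimes> A) \<boxtimes> (A \<boxtimes> B)\<close>, where pure tensors suffice, and only then evaluated at \<open>u = \<psi>(t)\<close>.\<close>

lemma twisting_lhs_eq:
  assumes s: "s \<in> carrier (B \<boxtimes> A)" and t: "t \<in> carrier (B \<boxtimes> A)"
  shows "twisting_lhs R A B \<psi> (pure_tensor R (B \<boxtimes> A) (B \<boxtimes> A) s t) = \<psi> s \<star> \<psi> t"
proof -
  have st: "pure_tensor R (B \<boxtimes> A) (A \<boxtimes> B) s (\<psi> t) \<in> carrier ((B \<boxtimes> A) \<boxtimes> (A \<boxtimes> B))"
    using s t by (intro pure_tensor_closed modules module_tensor twist_closed)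
  have "(tensor_map R A (B \<boxtimes> B) A B id (alg_mult R B)
   \<circ> tensor_assoc R A B B
   \<circ> tensor_map R (B \<boxtimes> A) B (A \<boxtimes> B) B \<psi> id
   \<circ> tensor_map R (B \<boxtimes> (A \<boxtimes> A)) B (B \<boxtimes> A) B (tensor_map R B (A \<boxtimes> A) B A id (alg_mult R A)) id
   \<circ> tensor_map R (B \<boxtimes> A \<boxtimes> A) B (B \<boxtimes> (A \<boxtimes> A)) B (tensor_assoc R B A A) id
   \<circ> tensor_assoc_inv R (B \<boxtimes> A) A B) (pure_tensor R (B \<boxtimes> A) (A \<boxtimes> B) s (\<psi> t)) =
   (twisted_mult R A B (tensor_flip R A B) \<circ> tensor_map R (B \<boxtimes> A) (A \<boxtimes> B) (A \<boxtimes> B) (A \<boxtimes> B) \<psi> id)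
     (pure_tensor R (B \<boxtimes> A) (A \<boxtimes> B) s (\<psi> t))"
  proof (rule tensor_hom_eqI4[where P = "A \<boxtimes> B", OF B.module_axioms A.module_axioms modules _ _ _ st], goal_cases)
    case 1 show ?case by (rule hom_intros twist_hom)+
  next
    case 2 show ?case by (rule star_tensor_hom hom_intros twist_hom)+
  next
    case (3 b a \<alpha> \<beta>)
    then show ?case
      by (subst star_tensor_pure)
        (simp_all add: pure_simps twist_hom mult_right_eq_star twist_closed BA_closed twist_mult_right)
  qed
  then show ?thesis
    using s t
    by (simp add: twisting_lhs_def pure_simps twist_hom twist_closed tensor_mult_def)
qed

lemma twisting_rhs_eq:
  assumes s: "s \<in> carrier (B \<boxtimes> A)" and t: "t \<in> carrier (B \<boxtimes> A)"
  shows "twisting_rhs R A B \<psi> (pure_tensor R (B \<boxtimes> A) (B \<boxtimes> A) s t) = \<psi> s \<star> \<psi> t"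
proof -
  have st: "pure_tensor R (A \<boxtimes> B) (B \<boxtimes> A) (\<psi> s) t \<in> carrier ((A \<boxtimes> B) \<boxtimes> (B \<boxtimes> A))"
    using s t by (intro pure_tensor_closed modules module_tensor twist_closed)
  have "(tensor_map R (A \<boxtimes> A) B A B (alg_mult R A) id
   \<circ> tensor_assoc_inv R A A B
   \<circ> tensor_map R A (B \<boxtimes> A) A (A \<boxtimes> B) id \<psi>
   \<circ> tensor_map R A (B \<boxtimes> B \<boxtimes> A) A (B \<boxtimes> A) id (tensor_map R (B \<boxtimes> B) A B A (alg_mult R B) id)
   \<circ> tensor_map R A (B \<boxtimes> (B \<boxtimes> A)) A (B \<boxtimes> B \<boxtimes> A) id (tensor_assoc_inv R B B A)
   \<circ> tensor_assoc R A B (B \<boxtimes> A)) (pure_tensor R (A \<boxtimes> B) (B \<boxtimes> A) (\<psi> s) t) =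
   (twisted_mult R A B (tensor_flip R A B) \<circ> tensor_map R (A \<boxtimes> B) (B \<boxtimes> A) (A \<boxtimes> B) (A \<boxtimes> B) id \<psi>)
     (pure_tensor R (A \<boxtimes> B) (B \<boxtimes> A) (\<psi> s) t)"
  proof (rule tensor_hom_eqI4[where P = "A \<boxtimes> B", OF modules B.module_axioms A.module_axioms _ _ _ st], goal_cases)
    case 1 show ?case by (rule hom_intros twist_hom)+
  next
    case 2 show ?case by (rule star_tensor_hom hom_intros twist_hom)+
  next
    case (3 \<alpha> \<beta> b a)
    then show ?case
      by (subst star_tensor_pure)
        (simp_all add: pure_simps twist_hom mult_left_eq_star twist_closed BA_closed twist_mult_left)
  qed
  then show ?thesis
    using s t
    by (simp add: twisting_rhs_def pure_simps twist_hom twist_closed tensor_mult_def)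
qed

lemma twisting_lhs_hom:
  "twisting_lhs R A B \<psi> \<in> module_hom R ((B \<boxtimes> A) \<boxtimes> (B \<boxtimes> A)) (A \<boxtimes> B)"
  unfolding twisting_lhs_def by (rule hom_intros twist_hom)+

lemma twisting_rhs_hom:
  "twisting_rhs R A B \<psi> \<in> module_hom R ((B \<boxtimes> A) \<boxtimes> (B \<boxtimes> A)) (A \<boxtimes> B)"
  unfolding twisting_rhs_def by (rule hom_intros twist_hom)+

theorem twisting_equation:
  "t \<in> carrier ((B \<boxtimes> A) \<boxtimes> (B \<boxtimes> A)) \<Longrightarrow> twisting_lhs R A B \<psi> t = twisting_rhs R A B \<psi> t"
  by (rule tensor_hom_eqI[OF _ _ twisting_lhs_hom twisting_rhs_hom])
    (simp_all add: modules module_tensor twisting_lhs_eq twisting_rhs_eq)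

lemma twisted_mult_eq:
  assumes x: "x \<in> carrier (A \<boxtimes> B)" and y: "y \<in> carrier (A \<boxtimes> B)"
  shows "twisted_mult R A B \<psi> (pure_tensor R (A \<boxtimes> B) (A \<boxtimes> B) x y) = x \<star> w \<star> y"
proof -
  have xy: "pure_tensor R (A \<boxtimes> B) (A \<boxtimes> B) x y \<in> carrier ((A \<boxtimes> B) \<boxtimes> (A \<boxtimes> B))"
    using x y by (intro pure_tensor_closed modules module_tensor)
  have "twisted_mult R A B \<psi> (pure_tensor R (A \<boxtimes> B) (A \<boxtimes> B) x y) =
    (twisted_mult R A B (tensor_flip R A B) \<circ>
      tensor_map R (A \<boxtimes> B) (A \<boxtimes> B) (A \<boxtimes> B) (A \<boxtimes> B) (\<lambda>x. x \<star> w) id)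
      (pure_tensor R (A \<boxtimes> B) (A \<boxtimes> B) x y)"
  proof (rule tensor_hom_eqI4[where P = "A \<boxtimes> B", OF modules modules _ _ _ xy], goal_cases)
    case 1 show ?case by (rule twisted_mult_hom[OF twist])
  next
    case 2 show ?case by (rule star_tensor_hom hom_intros star_hom twist_one_closed)+
  next
    case (3 a b a' b')
    then have "twisted_mult R A B \<psi> (pure_tensor R (A \<boxtimes> B) (A \<boxtimes> B) (a \<otimes>\<^sub>p b) (a' \<otimes>\<^sub>p b')) =
        \<iota>\<^sub>A a \<star> (\<iota>\<^sub>B b \<star> w \<star> \<iota>\<^sub>A a') \<star> \<iota>\<^sub>B b'"
      by (simp add: twisted_mult_pure[OF twist] tensor_map_eq_star twist_closed BA_closed twist_pure[symmetric])
    \<comment> \<open>Rebracketing brings \<open>1 \<otimes> b\<close> next to \<open>a \<otimes> 1\<close> and leaves \<open>w\<close> as the only trace of \<open>\<psi>\<close>.\<close>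
    also have "\<dots> = (\<iota>\<^sub>A a \<star> \<iota>\<^sub>B b) \<star> w \<star> (\<iota>\<^sub>A a' \<star> \<iota>\<^sub>B b')"
      using 3 by (simp add: star_simps)
    also have "\<dots> = (a \<otimes>\<^sub>p b) \<star> w \<star> (a' \<otimes>\<^sub>p b')"
      using 3 by (simp add: star_pure)
    finally show ?case
      using 3 by (subst star_tensor_pure) (simp_all add: hom_intros star_hom twist_one_closed pure_closed)
  qed
  also have "\<dots> = x \<star> w \<star> y"
    using x y by (subst star_tensor_pure) (simp_all add: star_hom twist_one_closed hom_intros)
  finally show ?thesis .
qed

theorem twisted_mult_associative: "associative_product R (A \<boxtimes> B) (twisted_mult R A B \<psi>)"
  unfolding associative_product_def
  by (simp add: twisted_mult_hom[OF twist] twisted_mult_eq star_closed twist_one_closed star_assoc)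

end

theorem theorem6p15:
  fixes k :: "'k ring"
    and A :: "('k, 'a) module"
    and B :: "('k, 'b) module"
    and \<psi> :: "('b \<times> 'a \<Rightarrow> 'k) set \<Rightarrow> ('a \<times> 'b \<Rightarrow> 'k) set"
  assumes "field k"
    and "unital_algebra k A"
    and "unital_algebra k B"
    and "\<psi> \<in> twist_maps k A B"
    and "\<psi> \<in> twist_bimodule_homs k A B"
  shows "(\<forall>t\<in>carrier ((B \<boxtimes>\<^bsub>k\<^esub> A) \<boxtimes>\<^bsub>k\<^esub> (B \<boxtimes>\<^bsub>k\<^esub> A)).
            twisting_lhs k A B \<psi> t = twisting_rhs k A B \<psi> t)
       \<and> associative_product k (A \<boxtimes>\<^bsub>k\<^esub> B) (twisted_mult k A B \<psi>)"
proof -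
  interpret A: unital_algebra k A by fact
  interpret B: unital_algebra k B by fact
  interpret bimodule_twist k A B \<psi>
    using assms(4,5) by unfold_locales
  show ?thesis using twisting_equation twisted_mult_associative by blast
qed

end
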